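(* Let $M^{q}$ be a submanifold of a Sasakian (resp. Kenmotsu, cosymplectic) space form $\widetilde{M}^{2n+1}_S(\tilde{c})$ (resp. $\widetilde{M}^{2n+1}_K(\tilde{c})$, $\widetilde{M}^{2n+1}_C(\tilde{c})$) with constant mean curvature $H$ so that $\xi$ and $\phi H$ are tangent to $M$, and let $f$ be a positive $C^\infty$ function on $M$. Let $F(f,q,\tilde{c})$ be the function on $M$ defined by $$F(f,q,\tilde{c})=qf_1-f_2+3f_3-\frac{\Delta f}{f}=\begin{cases}\frac{(q+2)\tilde{c}}{4}+\frac{3q-2}{4}-\frac{\Delta f}{f}&\text{for }\widetilde{M}^{2n+1}_S(\tilde{c}),\\[4pt]\frac{(q+2)\tilde{c}}{4}-\frac{3q-2}{4}-\frac{\Delta f}{f}&\text{for }\widetilde{M}^{2n+1}_K(\tilde{c}),\\[4pt]\frac{(q+2)\tilde{c}}{4}-\frac{\Delta f}{f}&\text{for }\widetilde{M}^{2n+1}_C(\tilde{c}).\end{cases}$$ Then: (1) If $\inf_MF(f,q,\tilde{c})$ is non-positive, then $M$ is not $f$-biharmonic. (2) If $\inf_MF(f,q,\tilde{c})$ is positive and $M$ is proper $f$-biharmonic, then $$0<|H|^2\leqslant\frac1q\inf_{M}F(f,q,\tilde{c}).$$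
   Context: An almost contact metric manifold $(\widetilde M,\widetilde g,\xi,\eta,\phi)$ is an odd-dimensional Riemannian manifold with a vector field $\xi$, a $1$-form $\eta$ and a $(1,1)$-tensor $\phi$ with $\eta(\xi)=1$, $\phi^2=-\mathrm{Id}+\eta\otimes\xi$, $\widetilde g(\phi X,\phi Y)=\widetilde g(X,Y)-\eta(X)\eta(Y)$, $\eta(X)=\widetilde g(X,\xi)$. Put $\Omega(X,Y)=\widetilde g(X,\phi Y)$. It is Sasakian if $(\nabla_X\phi)Y=\widetilde g(X,Y)\xi-\eta(Y)X$, Kenmotsu if $(\nabla_X\phi)Y=-\eta(Y)\phi X-\widetilde g(X,\phi Y)\xi$, cosymplectic if $\nabla\phi=0$. A Sasakian (resp. Kenmotsu, cosymplectic) space form $\widetilde M_S(\tilde c)$ (resp. $\widetilde M_K(\tilde c)$, $\widetilde M_C(\tilde c)$) is one of constant $\phi$-sectional curvature $\tilde c$ (sectional curvature of the planes $\{X,\phi X\}$). Its curvature tensor is $f_1R_1^\star+f_2R_2^\star+f_3R_3^\star$ with $f_1=\frac{\tilde c+3}4,f_2=f_3=\frac{\tilde c-1}4$ (resp. $f_1=\frac{\tilde c-3}4,f_2=f_3=\frac{\tilde c+1}4$; $f_1=f_2=f_3=\frac{\tilde c}4$), where $R_1^\star(X,Y)Z=\widetilde g(Y,Z)X-\widetilde g(X,Z)Y$, $R_2^\star(X,Y)Z=\eta(X)\eta(Z)Y-\eta(Y)\eta(Z)X+\widetilde g(X,Z)\eta(Y)\xi-\widetilde g(Y,Z)\eta(X)\xi$,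 $R_3^\star(X,Y)Z=\Omega(Z,Y)\phi X-\Omega(Z,X)\phi Y+2\Omega(X,Y)\phi Z$. Curvature convention: $R(X,Y)=[\nabla_X,\nabla_Y]-\nabla_{[X,Y]}$. Conventions: $H=\frac1q\mathrm{tr}B$ is the mean curvature vector, with $B$ the second fundamental form; constant mean curvature means that $|H|$ is constant. Laplacians are $\Delta V=\mathrm{tr}(\nabla^2V)$ (on functions and on sections of $\psi^{-1}(T\widetilde M)$, $\psi:M\to\widetilde M$ the isometric immersion). Tension field $\tau(\psi)=\mathrm{tr}\nabla d\psi=qH$; bitension field $\tau_2(\psi)=\Delta\tau(\psi)-\mathrm{tr}(R(d\psi,\tau(\psi))d\psi)$. $M$ is $f$-biharmonic if $\psi$ is a critical point of $E_{2,f}(\psi)=\frac12\int_Mf|\tau(\psi)|^2dv_g$, i.e. $f\tau_2(\psi)+(\Delta f)\tau(\psi)+2\nabla^\psi_{\mathrm{grad} f}\tau(\psi)=0$; it is proper $f$-biharmonic if moreover it is neither minimal ($\tau(\psi)=0$) nor biharmonic ($\tau_2(\psi)=0$).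
   Formalization: In F, Δf is read as −tr(∇²f) (the f-biharmonic equation keeps Δ = tr∇²), since the literal sign fails for the unit cylinder in R³ with f = e^t; in (1) M is assumed non-minimal, since every minimal M satisfies the f-biharmonic equation. *)

theory Defs
  imports "HOL-Analysis.Analysis"
begin

section \<open>Smooth maps and smooth manifolds\<close>

primrec Ck_on :: "nat \<Rightarrow> 'e::euclidean_space set \<Rightarrow> ('e \<Rightarrow> 'f::real_normed_vector) \<Rightarrow> bool" where
  "Ck_on 0 S F \<longleftrightarrow> continuous_on S F"
| "Ck_on (Suc k) S F \<longleftrightarrow>
     (\<forall>x\<in>S. F differentiable (at x)) \<and> (\<forall>v. Ck_on k S (\<lambda>x. frechet_derivative F (at x) v))"

text \<open>Only meant for open \<open>S\<close>.\<close>

definition smooth_on :: "'e::euclidean_space set \<Rightarrow> ('e \<Rightarrow> 'f::real_normed_vector) \<Rightarrow> bool" where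
  "smooth_on S F \<longleftrightarrow> (\<forall>k. Ck_on k S F)"

type_synonym ('a, 'm) chart = "'a set \<times> ('a \<Rightarrow> real ^ 'm)"

definition cdom :: "('a, 'm) chart \<Rightarrow> 'a set" where
  "cdom \<kappa> = fst \<kappa>"

definition coord :: "('a, 'm) chart \<Rightarrow> 'a \<Rightarrow> real ^ 'm" where
  "coord \<kappa> = snd \<kappa>"

definition cimg :: "('a, 'm) chart \<Rightarrow> (real ^ 'm) set" where
  "cimg \<kappa> = coord \<kappa> ` cdom \<kappa>"

definition param :: "('a, 'm) chart \<Rightarrow> real ^ 'm \<Rightarrow> 'a" where
  "param \<kappa> = inv_into (cdom \<kappa>) (coord \<kappa>)"

definition overlap :: "('a, 'm) chart \<Rightarrow> ('a, 'm) chart \<Rightarrow> (real ^ 'm) set" where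
  "overlap \<kappa> \<kappa>' = coord \<kappa> ` (cdom \<kappa> \<inter> cdom \<kappa>')"

definition trans_map :: "('a, 'm) chart \<Rightarrow> ('a, 'm) chart \<Rightarrow> real ^ 'm \<Rightarrow> real ^ 'm" where
  "trans_map \<kappa> \<kappa>' = coord \<kappa>' \<circ> param \<kappa>"

text \<open>The manifold is the whole type \<open>'a\<close>, its topology the type-class topology (Hausdorff and
  second countable), its dimension \<open>CARD('m)\<close>.\<close>

definition smooth_atlas ::
  "('a::{t2_space,second_countable_topology}, 'm::finite) chart set \<Rightarrow> bool" where
  "smooth_atlas A \<longleftrightarrow>
     (\<Union>\<kappa>\<in>A. cdom \<kappa>) = UNIV \<and>
     (\<forall>\<kappa>\<in>A. open (cdom \<kappa>) \<and> open (cimg \<kappa>) \<and>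
        homeomorphism (cdom \<kappa>) (cimg \<kappa>) (coord \<kappa>) (param \<kappa>)) \<and>
     (\<forall>\<kappa>\<in>A. \<forall>\<kappa>'\<in>A. smooth_on (overlap \<kappa> \<kappa>') (trans_map \<kappa> \<kappa>'))"

definition smooth_function :: "('a, 'm::finite) chart set \<Rightarrow> ('a \<Rightarrow> real) \<Rightarrow> bool" where
  "smooth_function A f \<longleftrightarrow> (\<forall>\<kappa>\<in>A. smooth_on (cimg \<kappa>) (f \<circ> param \<kappa>))"


section \<open>Tensor fields\<close>

abbreviation dd :: "('e::real_normed_vector \<Rightarrow> 'f::real_normed_vector) \<Rightarrow> 'e \<Rightarrow> 'e \<Rightarrow> 'f" where
  "dd F u v \<equiv> frechet_derivative F (at u) v"

text \<open>A tensor field is given by its local representatives: one on the coordinate image of each chart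
  of the atlas, related by the tensor transformation law under the transition maps. In a chart,
  tangent vectors are elements of \<open>real ^ 'm\<close>, a constant map stands for a field with constant
  components, and \<open>axis i 1\<close> is the \<open>i\<close>-th coordinate field.\<close>

type_synonym 'm lvec = "real ^ 'm \<Rightarrow> real ^ 'm"
type_synonym 'm lform = "real ^ 'm \<Rightarrow> real ^ 'm \<Rightarrow> real"
type_synonym 'm lendo = "real ^ 'm \<Rightarrow> real ^ 'm \<Rightarrow> real ^ 'm"
type_synonym 'm lmetric = "real ^ 'm \<Rightarrow> real ^ 'm \<Rightarrow> real ^ 'm \<Rightarrow> real"

definition vector_field ::
  "('a, 'm::finite) chart set \<Rightarrow> (('a, 'm) chart \<Rightarrow> 'm lvec) \<Rightarrow> bool" where
  "vector_field A X \<longleftrightarrow>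
     (\<forall>\<kappa>\<in>A. smooth_on (cimg \<kappa>) (X \<kappa>)) \<and>
     (\<forall>\<kappa>\<in>A. \<forall>\<kappa>'\<in>A. \<forall>u\<in>overlap \<kappa> \<kappa>'.
        X \<kappa>' (trans_map \<kappa> \<kappa>' u) = dd (trans_map \<kappa> \<kappa>') u (X \<kappa> u))"

definition one_form ::
  "('a, 'm::finite) chart set \<Rightarrow> (('a, 'm) chart \<Rightarrow> 'm lform) \<Rightarrow> bool" where
  "one_form A \<eta> \<longleftrightarrow>
     (\<forall>\<kappa>\<in>A. (\<forall>u\<in>cimg \<kappa>. linear (\<eta> \<kappa> u)) \<and> (\<forall>v. smooth_on (cimg \<kappa>) (\<lambda>u. \<eta> \<kappa> u v))) \<and>
     (\<forall>\<kappa>\<in>A. \<forall>\<kappa>'\<in>A. \<forall>u\<in>overlap \<kappa> \<kappa>'. \<forall>v.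
        \<eta> \<kappa>' (trans_map \<kappa> \<kappa>' u) (dd (trans_map \<kappa> \<kappa>') u v) = \<eta> \<kappa> u v)"

definition endo_field ::
  "('a, 'm::finite) chart set \<Rightarrow> (('a, 'm) chart \<Rightarrow> 'm lendo) \<Rightarrow> bool" where
  "endo_field A \<phi> \<longleftrightarrow>
     (\<forall>\<kappa>\<in>A. (\<forall>u\<in>cimg \<kappa>. linear (\<phi> \<kappa> u)) \<and> (\<forall>v. smooth_on (cimg \<kappa>) (\<lambda>u. \<phi> \<kappa> u v))) \<and>
     (\<forall>\<kappa>\<in>A. \<forall>\<kappa>'\<in>A. \<forall>u\<in>overlap \<kappa> \<kappa>'. \<forall>v.
        \<phi> \<kappa>' (trans_map \<kappa> \<kappa>' u) (dd (trans_map \<kappa> \<kappa>') u v)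
          = dd (trans_map \<kappa> \<kappa>') u (\<phi> \<kappa> u v))"

definition riemannian_metric ::
  "('a, 'm::finite) chart set \<Rightarrow> (('a, 'm) chart \<Rightarrow> 'm lmetric) \<Rightarrow> bool" where
  "riemannian_metric A g \<longleftrightarrow>
     (\<forall>\<kappa>\<in>A. (\<forall>u\<in>cimg \<kappa>. bilinear (g \<kappa> u) \<and> (\<forall>v w. g \<kappa> u v w = g \<kappa> u w v) \<and>
                         (\<forall>v. v \<noteq> 0 \<longrightarrow> 0 < g \<kappa> u v v)) \<and>
            (\<forall>v w. smooth_on (cimg \<kappa>) (\<lambda>u. g \<kappa> u v w))) \<and>
     (\<forall>\<kappa>\<in>A. \<forall>\<kappa>'\<in>A. \<forall>u\<in>overlap \<kappa> \<kappa>'. \<forall>v w.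
        g \<kappa>' (trans_map \<kappa> \<kappa>' u) (dd (trans_map \<kappa> \<kappa>') u v) (dd (trans_map \<kappa> \<kappa>') u w)
          = g \<kappa> u v w)"

definition riemannian_manifold ::
  "('a::{t2_space,second_countable_topology}, 'm::finite) chart set
    \<Rightarrow> (('a, 'm) chart \<Rightarrow> 'm lmetric) \<Rightarrow> bool" where
  "riemannian_manifold A g \<longleftrightarrow> smooth_atlas A \<and> riemannian_metric A g"


section \<open>Riemannian geometry in a chart\<close>

definition gram_inv :: "'m::finite lmetric \<Rightarrow> real ^ 'm \<Rightarrow> real ^ 'm ^ 'm" where
  "gram_inv g u = matrix_inv (\<chi> i j. g u (axis i 1) (axis j 1))"

text \<open>Trace of a bilinear map, \<open>g\<^sup>i\<^sup>j b(\<partial>\<^sub>i, \<partial>\<^sub>j)\<close>.\<close>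

definition mtrace ::
  "'m::finite lmetric \<Rightarrow> real ^ 'm \<Rightarrow> (real ^ 'm \<Rightarrow> real ^ 'm \<Rightarrow> 'v::real_vector) \<Rightarrow> 'v" where
  "mtrace g u b = (\<Sum>i\<in>UNIV. \<Sum>j\<in>UNIV. (gram_inv g u $ i $ j) *\<^sub>R b (axis i 1) (axis j 1))"

text \<open>\<open>christoffel g u v w\<close> is \<open>\<nabla>\<^sub>v w\<close> at \<open>u\<close> for fields with constant components \<open>v\<close> and \<open>w\<close>.\<close>

definition christoffel :: "'m::finite lmetric \<Rightarrow> real ^ 'm \<Rightarrow> real ^ 'm \<Rightarrow> real ^ 'm \<Rightarrow> real ^ 'm" where
  "christoffel g u v w = (\<chi> k. \<Sum>l\<in>UNIV. gram_inv g u $ k $ l *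
     ((dd (\<lambda>s. g s w (axis l 1)) u v + dd (\<lambda>s. g s v (axis l 1)) u w
        - dd (\<lambda>s. g s v w) u (axis l 1)) / 2))"

definition nabla :: "'m::finite lmetric \<Rightarrow> 'm lvec \<Rightarrow> 'm lvec \<Rightarrow> 'm lvec" where
  "nabla g X Y u = dd Y u (X u) + christoffel g u (X u) (Y u)"

definition lie_bracket :: "'m::finite lvec \<Rightarrow> 'm lvec \<Rightarrow> 'm lvec" where
  "lie_bracket X Y u = dd Y u (X u) - dd X u (Y u)"

definition curvature ::
  "'m::finite lmetric \<Rightarrow> 'm lvec \<Rightarrow> 'm lvec \<Rightarrow> 'm lvec \<Rightarrow> 'm lvec" where
  "curvature g X Y Z u =
     nabla g X (nabla g Y Z) u - nabla g Y (nabla g X Z) u - nabla g (lie_bracket X Y) Z u"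

text \<open>The value of a tensorial expression on vectors at a point is obtained by extending the vectors
  with constant components.\<close>

definition curv ::
  "'m::finite lmetric \<Rightarrow> real ^ 'm \<Rightarrow> real ^ 'm \<Rightarrow> real ^ 'm \<Rightarrow> real ^ 'm \<Rightarrow> real ^ 'm" where
  "curv g u x y z = curvature g (\<lambda>_. x) (\<lambda>_. y) (\<lambda>_. z) u"

definition sectional ::
  "'m::finite lmetric \<Rightarrow> real ^ 'm \<Rightarrow> real ^ 'm \<Rightarrow> real ^ 'm \<Rightarrow> real" where
  "sectional g u x y = g u (curv g u x y y) x / (g u x x * g u y y - (g u x y)\<^sup>2)"

definition nabla_endo ::
  "'m::finite lmetric \<Rightarrow> 'm lendo \<Rightarrow> 'm lvec \<Rightarrow> 'm lvec \<Rightarrow> 'm lvec" where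
  "nabla_endo g \<phi> X Y u = nabla g X (\<lambda>s. \<phi> s (Y s)) u - \<phi> u (nabla g X Y u)"

text \<open>\<open>local_laplacian\<close> is \<open>tr(\<nabla>\<^sup>2 F)\<close>.\<close>

definition hessian ::
  "'m::finite lmetric \<Rightarrow> (real ^ 'm \<Rightarrow> real) \<Rightarrow> 'm lvec \<Rightarrow> 'm lvec \<Rightarrow> real ^ 'm \<Rightarrow> real" where
  "hessian g F X Y u = dd (\<lambda>s. dd F s (Y s)) u (X u) - dd F u (nabla g X Y u)"

definition local_laplacian ::
  "'m::finite lmetric \<Rightarrow> (real ^ 'm \<Rightarrow> real) \<Rightarrow> real ^ 'm \<Rightarrow> real" where
  "local_laplacian g F u = mtrace g u (\<lambda>x y. hessian g F (\<lambda>_. x) (\<lambda>_. y) u)"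

definition local_grad :: "'m::finite lmetric \<Rightarrow> (real ^ 'm \<Rightarrow> real) \<Rightarrow> 'm lvec" where
  "local_grad g F u = (\<chi> k. \<Sum>l\<in>UNIV. gram_inv g u $ k $ l * dd F u (axis l 1))"


section \<open>Geometry of a map in charts\<close>

text \<open>Below, \<open>g\<close> is a metric on the domain, \<open>h\<close> a metric on the target, \<open>P\<close> a map between coordinate
  domains and \<open>V\<close> a section of the pullback of the tangent bundle of the target along \<open>P\<close>.\<close>

definition pullback_nabla ::
  "'m::finite lmetric \<Rightarrow> (real ^ 'q \<Rightarrow> real ^ 'm) \<Rightarrow> 'q::finite lvec
    \<Rightarrow> (real ^ 'q \<Rightarrow> real ^ 'm) \<Rightarrow> real ^ 'q \<Rightarrow> real ^ 'm" where
  "pullback_nabla h P X V u = dd V u (X u) + christoffel h (P u) (dd P u (X u)) (V u)"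

definition section_laplacian ::
  "'q::finite lmetric \<Rightarrow> 'm::finite lmetric \<Rightarrow> (real ^ 'q \<Rightarrow> real ^ 'm)
    \<Rightarrow> (real ^ 'q \<Rightarrow> real ^ 'm) \<Rightarrow> real ^ 'q \<Rightarrow> real ^ 'm" where
  "section_laplacian g h P V u = mtrace g u (\<lambda>x y.
     pullback_nabla h P (\<lambda>_. x) (pullback_nabla h P (\<lambda>_. y) V) u
       - pullback_nabla h P (nabla g (\<lambda>_. x) (\<lambda>_. y)) V u)"

definition second_fund ::
  "'q::finite lmetric \<Rightarrow> 'm::finite lmetric \<Rightarrow> (real ^ 'q \<Rightarrow> real ^ 'm)
    \<Rightarrow> 'q lvec \<Rightarrow> 'q lvec \<Rightarrow> real ^ 'q \<Rightarrow> real ^ 'm" where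
  "second_fund g h P X Y u =
     pullback_nabla h P X (\<lambda>s. dd P s (Y s)) u - dd P u (nabla g X Y u)"

definition tension ::
  "'q::finite lmetric \<Rightarrow> 'm::finite lmetric \<Rightarrow> (real ^ 'q \<Rightarrow> real ^ 'm)
    \<Rightarrow> real ^ 'q \<Rightarrow> real ^ 'm" where
  "tension g h P u = mtrace g u (\<lambda>x y. second_fund g h P (\<lambda>_. x) (\<lambda>_. y) u)"

definition mean_curvature_vector ::
  "'q::finite lmetric \<Rightarrow> 'm::finite lmetric \<Rightarrow> (real ^ 'q \<Rightarrow> real ^ 'm)
    \<Rightarrow> real ^ 'q \<Rightarrow> real ^ 'm" where
  "mean_curvature_vector g h P u =
     (1 / real CARD('q)) *\<^sub>R mtrace g u (\<lambda>x y. second_fund g h P (\<lambda>_. x) (\<lambda>_. y) u)"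

definition bitension ::
  "'q::finite lmetric \<Rightarrow> 'm::finite lmetric \<Rightarrow> (real ^ 'q \<Rightarrow> real ^ 'm)
    \<Rightarrow> real ^ 'q \<Rightarrow> real ^ 'm" where
  "bitension g h P u = section_laplacian g h P (tension g h P) u
     - mtrace g u (\<lambda>x y. curv h (P u) (dd P u x) (tension g h P u) (dd P u y))"


section \<open>Almost contact metric manifolds and space forms\<close>

definition almost_contact_metric_manifold ::
  "('a::{t2_space,second_countable_topology}, 'm::finite) chart set
    \<Rightarrow> (('a, 'm) chart \<Rightarrow> 'm lmetric) \<Rightarrow> (('a, 'm) chart \<Rightarrow> 'm lvec)
    \<Rightarrow> (('a, 'm) chart \<Rightarrow> 'm lform) \<Rightarrow> (('a, 'm) chart \<Rightarrow> 'm lendo) \<Rightarrow> bool" where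
  "almost_contact_metric_manifold A h \<xi> \<eta> \<phi> \<longleftrightarrow>
     odd CARD('m) \<and> riemannian_manifold A h \<and>
     vector_field A \<xi> \<and> one_form A \<eta> \<and> endo_field A \<phi> \<and>
     (\<forall>\<kappa>\<in>A. \<forall>u\<in>cimg \<kappa>.
        \<eta> \<kappa> u (\<xi> \<kappa> u) = 1 \<and>
        (\<forall>v. \<phi> \<kappa> u (\<phi> \<kappa> u v) = - v + \<eta> \<kappa> u v *\<^sub>R \<xi> \<kappa> u) \<and>
        (\<forall>v w. h \<kappa> u (\<phi> \<kappa> u v) (\<phi> \<kappa> u w) = h \<kappa> u v w - \<eta> \<kappa> u v * \<eta> \<kappa> u w) \<and>
        (\<forall>v. \<eta> \<kappa> u v = h \<kappa> u v (\<xi> \<kappa> u)))"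

datatype structure_kind = Sasakian | Kenmotsu | Cosymplectic

text \<open>The prescribed value of \<open>(\<nabla>\<^sub>x \<phi>) y\<close> for each kind of structure.\<close>

fun nabla_phi_rhs ::
  "structure_kind \<Rightarrow> 'm::finite lmetric \<Rightarrow> 'm lvec \<Rightarrow> 'm lform \<Rightarrow> 'm lendo
    \<Rightarrow> real ^ 'm \<Rightarrow> real ^ 'm \<Rightarrow> real ^ 'm \<Rightarrow> real ^ 'm" where
  "nabla_phi_rhs Sasakian h \<xi> \<eta> \<phi> u x y = h u x y *\<^sub>R \<xi> u - \<eta> u y *\<^sub>R x"
| "nabla_phi_rhs Kenmotsu h \<xi> \<eta> \<phi> u x y = - (\<eta> u y *\<^sub>R \<phi> u x) - h u x (\<phi> u y) *\<^sub>R \<xi> u"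
| "nabla_phi_rhs Cosymplectic h \<xi> \<eta> \<phi> u x y = 0"

text \<open>The planes \<open>{x, \<phi> x}\<close> are the usual \<open>\<phi>\<close>-sections, i.e. \<open>x\<close> is a nonzero vector orthogonal to \<open>\<xi>\<close>.\<close>

definition constant_phi_sectional_curvature ::
  "('a, 'm::finite) chart set \<Rightarrow> (('a, 'm) chart \<Rightarrow> 'm lmetric)
    \<Rightarrow> (('a, 'm) chart \<Rightarrow> 'm lform) \<Rightarrow> (('a, 'm) chart \<Rightarrow> 'm lendo) \<Rightarrow> real \<Rightarrow> bool" where
  "constant_phi_sectional_curvature A h \<eta> \<phi> c \<longleftrightarrow>
     (\<forall>\<kappa>\<in>A. \<forall>u\<in>cimg \<kappa>. \<forall>x. x \<noteq> 0 \<and> \<eta> \<kappa> u x = 0 \<longrightarrow>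
        sectional (h \<kappa>) u x (\<phi> \<kappa> u x) = c)"

definition space_form ::
  "structure_kind \<Rightarrow> ('a::{t2_space,second_countable_topology}, 'm::finite) chart set
    \<Rightarrow> (('a, 'm) chart \<Rightarrow> 'm lmetric) \<Rightarrow> (('a, 'm) chart \<Rightarrow> 'm lvec)
    \<Rightarrow> (('a, 'm) chart \<Rightarrow> 'm lform) \<Rightarrow> (('a, 'm) chart \<Rightarrow> 'm lendo) \<Rightarrow> real \<Rightarrow> bool" where
  "space_form S A h \<xi> \<eta> \<phi> c \<longleftrightarrow>
     almost_contact_metric_manifold A h \<xi> \<eta> \<phi> \<and>
     (\<forall>\<kappa>\<in>A. \<forall>u\<in>cimg \<kappa>. \<forall>x y. nabla_endo (h \<kappa>) (\<phi> \<kappa>) (\<lambda>_. x) (\<lambda>_. y) u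
        = nabla_phi_rhs S (h \<kappa>) (\<xi> \<kappa>) (\<eta> \<kappa>) (\<phi> \<kappa>) u x y) \<and>
     constant_phi_sectional_curvature A h \<eta> \<phi> c"

fun f1 :: "structure_kind \<Rightarrow> real \<Rightarrow> real" where
  "f1 Sasakian c = (c + 3) / 4"
| "f1 Kenmotsu c = (c - 3) / 4"
| "f1 Cosymplectic c = c / 4"

fun f2 :: "structure_kind \<Rightarrow> real \<Rightarrow> real" where
  "f2 Sasakian c = (c - 1) / 4"
| "f2 Kenmotsu c = (c + 1) / 4"
| "f2 Cosymplectic c = c / 4"

definition f3 :: "structure_kind \<Rightarrow> real \<Rightarrow> real" where
  "f3 = f2"


section \<open>Submanifolds\<close>

definition rep ::
  "('b, 'q) chart \<Rightarrow> ('a, 'm) chart \<Rightarrow> ('b \<Rightarrow> 'a) \<Rightarrow> real ^ 'q \<Rightarrow> real ^ 'm" where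
  "rep \<kappa> \<mu> \<psi> = coord \<mu> \<circ> \<psi> \<circ> param \<kappa>"

definition repdom ::
  "('b, 'q) chart \<Rightarrow> ('a, 'm) chart \<Rightarrow> ('b \<Rightarrow> 'a) \<Rightarrow> (real ^ 'q) set" where
  "repdom \<kappa> \<mu> \<psi> = coord \<kappa> ` (cdom \<kappa> \<inter> \<psi> -` cdom \<mu>)"

text \<open>The isometry condition forces the differential to be injective.\<close>

definition isometric_immersion ::
  "('b::topological_space, 'q::finite) chart set \<Rightarrow> (('b, 'q) chart \<Rightarrow> 'q lmetric)
    \<Rightarrow> ('a::topological_space, 'm::finite) chart set \<Rightarrow> (('a, 'm) chart \<Rightarrow> 'm lmetric)
    \<Rightarrow> ('b \<Rightarrow> 'a) \<Rightarrow> bool" where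
  "isometric_immersion B g A h \<psi> \<longleftrightarrow>
     continuous_on UNIV \<psi> \<and>
     (\<forall>\<kappa>\<in>B. \<forall>\<mu>\<in>A. smooth_on (repdom \<kappa> \<mu> \<psi>) (rep \<kappa> \<mu> \<psi>) \<and>
        (\<forall>u\<in>repdom \<kappa> \<mu> \<psi>. \<forall>v w.
           h \<mu> (rep \<kappa> \<mu> \<psi> u) (dd (rep \<kappa> \<mu> \<psi>) u v) (dd (rep \<kappa> \<mu> \<psi>) u w) = g \<kappa> u v w))"

definition xi_tangent ::
  "('b, 'q::finite) chart set \<Rightarrow> ('a, 'm::finite) chart set
    \<Rightarrow> (('a, 'm) chart \<Rightarrow> 'm lvec) \<Rightarrow> ('b \<Rightarrow> 'a) \<Rightarrow> bool" where
  "xi_tangent B A \<xi> \<psi> \<longleftrightarrow>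
     (\<forall>\<kappa>\<in>B. \<forall>\<mu>\<in>A. \<forall>u\<in>repdom \<kappa> \<mu> \<psi>.
        \<xi> \<mu> (rep \<kappa> \<mu> \<psi> u) \<in> range (dd (rep \<kappa> \<mu> \<psi>) u))"

definition phi_H_tangent ::
  "('b, 'q::finite) chart set \<Rightarrow> (('b, 'q) chart \<Rightarrow> 'q lmetric)
    \<Rightarrow> ('a, 'm::finite) chart set \<Rightarrow> (('a, 'm) chart \<Rightarrow> 'm lmetric)
    \<Rightarrow> (('a, 'm) chart \<Rightarrow> 'm lendo) \<Rightarrow> ('b \<Rightarrow> 'a) \<Rightarrow> bool" where
  "phi_H_tangent B g A h \<phi> \<psi> \<longleftrightarrow>
     (\<forall>\<kappa>\<in>B. \<forall>\<mu>\<in>A. \<forall>u\<in>repdom \<kappa> \<mu> \<psi>.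
        \<phi> \<mu> (rep \<kappa> \<mu> \<psi> u) (mean_curvature_vector (g \<kappa>) (h \<mu>) (rep \<kappa> \<mu> \<psi>) u)
          \<in> range (dd (rep \<kappa> \<mu> \<psi>) u))"

text \<open>The norm of the mean curvature vector is the constant \<open>r\<close>.\<close>

definition mean_curvature_constant ::
  "('b, 'q::finite) chart set \<Rightarrow> (('b, 'q) chart \<Rightarrow> 'q lmetric)
    \<Rightarrow> ('a, 'm::finite) chart set \<Rightarrow> (('a, 'm) chart \<Rightarrow> 'm lmetric)
    \<Rightarrow> ('b \<Rightarrow> 'a) \<Rightarrow> real \<Rightarrow> bool" where
  "mean_curvature_constant B g A h \<psi> r \<longleftrightarrow>
     (\<forall>\<kappa>\<in>B. \<forall>\<mu>\<in>A. \<forall>u\<in>repdom \<kappa> \<mu> \<psi>.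
        let H = mean_curvature_vector (g \<kappa>) (h \<mu>) (rep \<kappa> \<mu> \<psi>) u
        in sqrt (h \<mu> (rep \<kappa> \<mu> \<psi> u) H H) = r)"

definition minimal ::
  "('b, 'q::finite) chart set \<Rightarrow> (('b, 'q) chart \<Rightarrow> 'q lmetric)
    \<Rightarrow> ('a, 'm::finite) chart set \<Rightarrow> (('a, 'm) chart \<Rightarrow> 'm lmetric) \<Rightarrow> ('b \<Rightarrow> 'a) \<Rightarrow> bool" where
  "minimal B g A h \<psi> \<longleftrightarrow>
     (\<forall>\<kappa>\<in>B. \<forall>\<mu>\<in>A. \<forall>u\<in>repdom \<kappa> \<mu> \<psi>. tension (g \<kappa>) (h \<mu>) (rep \<kappa> \<mu> \<psi>) u = 0)"

definition biharmonic ::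
  "('b, 'q::finite) chart set \<Rightarrow> (('b, 'q) chart \<Rightarrow> 'q lmetric)
    \<Rightarrow> ('a, 'm::finite) chart set \<Rightarrow> (('a, 'm) chart \<Rightarrow> 'm lmetric) \<Rightarrow> ('b \<Rightarrow> 'a) \<Rightarrow> bool" where
  "biharmonic B g A h \<psi> \<longleftrightarrow>
     (\<forall>\<kappa>\<in>B. \<forall>\<mu>\<in>A. \<forall>u\<in>repdom \<kappa> \<mu> \<psi>. bitension (g \<kappa>) (h \<mu>) (rep \<kappa> \<mu> \<psi>) u = 0)"

definition f_biharmonic ::
  "('b, 'q::finite) chart set \<Rightarrow> (('b, 'q) chart \<Rightarrow> 'q lmetric)
    \<Rightarrow> ('a, 'm::finite) chart set \<Rightarrow> (('a, 'm) chart \<Rightarrow> 'm lmetric)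
    \<Rightarrow> ('b \<Rightarrow> real) \<Rightarrow> ('b \<Rightarrow> 'a) \<Rightarrow> bool" where
  "f_biharmonic B g A h f \<psi> \<longleftrightarrow>
     (\<forall>\<kappa>\<in>B. \<forall>\<mu>\<in>A. \<forall>u\<in>repdom \<kappa> \<mu> \<psi>.
        let P = rep \<kappa> \<mu> \<psi>; F = f \<circ> param \<kappa>; \<tau> = tension (g \<kappa>) (h \<mu>) P
        in F u *\<^sub>R bitension (g \<kappa>) (h \<mu>) P u + local_laplacian (g \<kappa>) F u *\<^sub>R \<tau> u
           + 2 *\<^sub>R pullback_nabla (h \<mu>) P (local_grad (g \<kappa>) F) \<tau> u = 0)"

definition proper_f_biharmonic ::
  "('b, 'q::finite) chart set \<Rightarrow> (('b, 'q) chart \<Rightarrow> 'q lmetric)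
    \<Rightarrow> ('a, 'm::finite) chart set \<Rightarrow> (('a, 'm) chart \<Rightarrow> 'm lmetric)
    \<Rightarrow> ('b \<Rightarrow> real) \<Rightarrow> ('b \<Rightarrow> 'a) \<Rightarrow> bool" where
  "proper_f_biharmonic B g A h f \<psi> \<longleftrightarrow>
     f_biharmonic B g A h f \<psi> \<and> \<not> minimal B g A h \<psi> \<and> \<not> biharmonic B g A h \<psi>"

text \<open>\<open>tr(\<nabla>\<^sup>2 f)\<close> at a point, computed in some chart around it; the value does not depend on the chart.\<close>

definition laplacian ::
  "('b, 'q::finite) chart set \<Rightarrow> (('b, 'q) chart \<Rightarrow> 'q lmetric) \<Rightarrow> ('b \<Rightarrow> real) \<Rightarrow> 'b \<Rightarrow> real" where
  "laplacian B g f p =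
     (let \<kappa> = (SOME \<kappa>. \<kappa> \<in> B \<and> p \<in> cdom \<kappa>)
      in local_laplacian (g \<kappa>) (f \<circ> param \<kappa>) (coord \<kappa> p))"

text \<open>The Laplacian of nonnegative spectrum, \<open>- tr(\<nabla>\<^sup>2 f) = - div (grad f)\<close>. This is the sign with
  which the Laplacian has to enter \<open>F_fun\<close>, given that the \<open>f\<close>-biharmonic equation above is written
  with \<open>tr(\<nabla>\<^sup>2 f)\<close>. With \<open>tr(\<nabla>\<^sup>2 f)\<close> in \<open>F_fun\<close> a nonminimal \<open>f\<close>-biharmonic submanifold can have negative
  \<open>F_fun\<close>: the unit cylinder in Euclidean 3-space, with \<open>\<xi>\<close> along its axis, is proper \<open>f\<close>-biharmonic
  for \<open>f = exp t\<close> (\<open>t\<close> the coordinate on the axis), while \<open>c = 0\<close> and \<open>tr(\<nabla>\<^sup>2 f) / f = 1\<close>.\<close>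

definition pos_laplacian ::
  "('b, 'q::finite) chart set \<Rightarrow> (('b, 'q) chart \<Rightarrow> 'q lmetric) \<Rightarrow> ('b \<Rightarrow> real) \<Rightarrow> 'b \<Rightarrow> real" where
  "pos_laplacian B g f p = - laplacian B g f p"

definition F_fun ::
  "structure_kind \<Rightarrow> ('b, 'q::finite) chart set \<Rightarrow> (('b, 'q) chart \<Rightarrow> 'q lmetric)
    \<Rightarrow> ('b \<Rightarrow> real) \<Rightarrow> real \<Rightarrow> 'b \<Rightarrow> real" where
  "F_fun S B g f c p =
     real CARD('q) * f1 S c - f2 S c + 3 * f3 S c - pos_laplacian B g f p / f p"

lemma F_fun_cases:
  fixes B :: "('b, 'q::finite) chart set"
  defines "q \<equiv> real CARD('q)"
  shows
  "F_fun Sasakian B g f c p = (q + 2) * c / 4 + (3 * q - 2) / 4 - pos_laplacian B g f p / f p"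
  "F_fun Kenmotsu B g f c p = (q + 2) * c / 4 - (3 * q - 2) / 4 - pos_laplacian B g f p / f p"
  "F_fun Cosymplectic B g f c p = (q + 2) * c / 4 - pos_laplacian B g f p / f p"
  by (simp_all add: F_fun_def f3_def q_def field_simps)

end

(*
Pairing the f-biharmonic equation with the tension field tau, whose length is constant, gives
|nabla tau|^2 = F |tau|^2: the derivative terms <nabla tau, tau> vanish, <Laplacian tau, tau> equals
- |nabla tau|^2, and the curvature trace only involves |tau|^2, |xi|^2 and |phi tau|^2 because
xi and phi tau are tangent to M. On the other hand the tangential part of nabla tau is minus the shape operator A_tau,
whose trace is |tau|^2, so Cauchy-Schwarz yields |nabla tau|^2 >= |tau|^4 / q. Hence q |H|^2 <= F pointwise.

The form of the curvature tensor is not a hypothesis. It follows from the formula for nabla phi: the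
Ricci identity expresses R(x,y) phi z - phi R(x,y) z, so the difference between R and the model
f1 R1 + f2 (R2 + R3) has the symmetries of a Kaehler curvature tensor, and its holomorphic sectional
curvature vanishes; polarisation then kills all its sectional curvatures.
*)
theory Submission
  imports Defs
begin

section \<open>Calculus of smooth maps\<close>

text \<open>All computations happen in one pair of charts: a vector at a point is extended with
  constant components, so brackets vanish and covariant derivatives of extensions are Christoffel
  symbols. Traces are contractions with \<open>gram_inv\<close>; no orthonormal frame is used, and
  Cauchy-Schwarz takes the form that a semidefinite bilinear form has non-negative trace. The
  Kaehler symmetries come from the splitting f1 = eps + f2. For each kind of structure, the failure
  of R to commute with \<phi> is that of eps R1 alone, whereas R1 + R2 + R3 commutes with \<phi>. So
  the difference of R and the model commutes with \<phi>, and this forces it to vanish in the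
  direction \<xi>, where \<phi> is not a complex structure. The derivative of \<xi>, which the
  definitions do not prescribe, follows from \<phi> \<xi> = 0 and |\<xi>| = 1. The equation is
  paired with \<tau>, so only the values <R(x,\<tau>)y,\<tau>> of the curvature have to be
  identified.\<close>

lemma dd_eqI: "(F has_derivative D) (at u) \<Longrightarrow> dd F u v = D v"
  using frechet_derivative_at by metis

lemma dd_works: "F differentiable (at u) \<Longrightarrow> (F has_derivative (\<lambda>v. dd F u v)) (at u)"
  by (simp add: frechet_derivative_works)

lemma linear_dd: "F differentiable (at u) \<Longrightarrow> linear (dd F u)"
  by (rule linear_frechet_derivative)

text \<open>\<open>frechet_derivative\<close> is a choice among the derivatives at a point.
  Functions that agree near the point have the same derivatives, so the choices agree, also where no
  derivative exists.\<close>

lemma dd_cong: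
  assumes "open S" "u \<in> S" "\<And>x. x \<in> S \<Longrightarrow> F x = G x"
  shows "dd F u v = dd G u v"
proof -
  have "(F has_derivative D) (at u) \<longleftrightarrow> (G has_derivative D) (at u)" for D
    using has_derivative_transform_within_open[of F D u UNIV S G]
      has_derivative_transform_within_open[of G D u UNIV S F] assms by auto
  then show ?thesis unfolding frechet_derivative_def by simp
qed

lemma differentiable_cong:
  assumes "open S" "u \<in> S" "\<And>x. x \<in> S \<Longrightarrow> F x = G x" "F differentiable (at u)"
  shows "G differentiable (at u)"
  using assms has_derivative_transform_within_open[of F _ u UNIV S G]
  unfolding differentiable_def by metis

lemma Ck_on_cong:
  assumes "open S" "\<And>x. x \<in> S \<Longrightarrow> F x = G x" "Ck_on k S F"
  shows "Ck_on k S G"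
  using assms(2,3)
proof (induction k arbitrary: F G)
  case 0
  then show ?case using continuous_on_cong[of S S F G] by simp
next
  case (Suc k)
  have "Ck_on k S (\<lambda>x. dd G x v)" for v
  proof (rule Suc.IH)
    show "dd F x v = dd G x v" if "x \<in> S" for x
      using dd_cong[OF assms(1) that Suc.prems(1)] .
    show "Ck_on k S (\<lambda>x. dd F x v)" using Suc.prems(2) by simp
  qed
  moreover have "G differentiable (at x)" if "x \<in> S" for x
    using differentiable_cong[OF assms(1) that Suc.prems(1)] Suc.prems(2) that by simp
  ultimately show ?case by simp
qed

lemma Ck_on_Suc_imp: "Ck_on (Suc k) S F \<Longrightarrow> Ck_on k S F"
proof (induction k arbitrary: F)
  case 0
  then show ?case
    by (auto intro!: continuous_at_imp_continuous_on differentiable_imp_continuous_within)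
next
  case (Suc k)
  then show ?case by simp
qed

lemma Ck_on_subset: "Ck_on k S F \<Longrightarrow> T \<subseteq> S \<Longrightarrow> Ck_on k T F"
  by (induction k arbitrary: F) (auto intro: continuous_on_subset)

lemma Ck_on_const: "Ck_on k S (\<lambda>x. a)"
  by (induction k arbitrary: a) auto

lemma Ck_on_bounded_linear:
  assumes "open S" "bounded_linear L" "Ck_on k S F"
  shows "Ck_on k S (\<lambda>x. L (F x))"
  using assms(3)
proof (induction k arbitrary: F)
  case 0
  then show ?case using assms(2) by (simp add: bounded_linear.continuous_on)
next
  case (Suc k)
  have d: "((\<lambda>x. L (F x)) has_derivative (\<lambda>v. L (dd F x v))) (at x)" if "x \<in> S" for x
    using Suc.prems that by (intro bounded_linear.has_derivative[OF assms(2)] dd_works) auto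
  have "Ck_on k S (\<lambda>x. dd (\<lambda>x. L (F x)) x v)" for v
  proof (rule Ck_on_cong[OF assms(1)])
    show "Ck_on k S (\<lambda>x. L (dd F x v))" using Suc.prems by (intro Suc.IH) simp
  qed (simp add: dd_eqI[OF d])
  moreover have "\<And>x. x \<in> S \<Longrightarrow> (\<lambda>x. L (F x)) differentiable (at x)"
    using d unfolding differentiable_def by blast
  ultimately show ?case by simp
qed

lemma Ck_on_add:
  assumes "open S" "Ck_on k S F" "Ck_on k S G"
  shows "Ck_on k S (\<lambda>x. F x + G x)"
  using assms(2,3)
proof (induction k arbitrary: F G)
  case 0
  then show ?case by (simp add: continuous_on_add)
next
  case (Suc k)
  have d: "((\<lambda>x. F x + G x) has_derivative (\<lambda>v. dd F x v + dd G x v)) (at x)" if "x \<in> S" for x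
    using Suc.prems that by (intro has_derivative_add dd_works) auto
  have "Ck_on k S (\<lambda>x. dd (\<lambda>x. F x + G x) x v)" for v
  proof (rule Ck_on_cong[OF assms(1)])
    show "Ck_on k S (\<lambda>x. dd F x v + dd G x v)" using Suc.prems by (intro Suc.IH) simp_all
  qed (simp add: dd_eqI[OF d])
  moreover have "\<And>x. x \<in> S \<Longrightarrow> (\<lambda>x. F x + G x) differentiable (at x)"
    using d unfolding differentiable_def by blast
  ultimately show ?case by simp
qed

lemma Ck_on_bounded_bilinear:
  assumes "open S" "bounded_bilinear b" "Ck_on k S F" "Ck_on k S G"
  shows "Ck_on k S (\<lambda>x. b (F x) (G x))"
  using assms(3,4)
proof (induction k arbitrary: F G)
  case 0
  then show ?case using bounded_bilinear.continuous_on[OF assms(2)] by simp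
next
  case (Suc k)
  have d: "((\<lambda>x. b (F x) (G x)) has_derivative (\<lambda>v. b (F x) (dd G x v) + b (dd F x v) (G x))) (at x)"
    if "x \<in> S" for x
    using Suc.prems that by (intro bounded_bilinear.FDERIV[OF assms(2)] dd_works) auto
  have "Ck_on k S (\<lambda>x. dd (\<lambda>x. b (F x) (G x)) x v)" for v
  proof (rule Ck_on_cong[OF assms(1)])
    show "Ck_on k S (\<lambda>x. b (F x) (dd G x v) + b (dd F x v) (G x))"
      using Suc.prems Ck_on_Suc_imp[OF Suc.prems(1)] Ck_on_Suc_imp[OF Suc.prems(2)]
      by (intro Ck_on_add[OF assms(1)] Suc.IH) simp_all
  qed (simp add: dd_eqI[OF d])
  moreover have "\<And>x. x \<in> S \<Longrightarrow> (\<lambda>x. b (F x) (G x)) differentiable (at x)"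
    using d unfolding differentiable_def by blast
  ultimately show ?case by simp
qed

lemma smooth_on_cong:
  "open S \<Longrightarrow> (\<And>x. x \<in> S \<Longrightarrow> F x = G x) \<Longrightarrow> smooth_on S F \<Longrightarrow> smooth_on S G"
  unfolding smooth_on_def using Ck_on_cong by blast

lemma smooth_on_subset: "smooth_on S F \<Longrightarrow> T \<subseteq> S \<Longrightarrow> smooth_on T F"
  unfolding smooth_on_def using Ck_on_subset by blast

lemma smooth_on_const: "smooth_on S (\<lambda>x. a)"
  unfolding smooth_on_def using Ck_on_const by blast

lemma smooth_on_bounded_linear:
  "open S \<Longrightarrow> bounded_linear L \<Longrightarrow> smooth_on S F \<Longrightarrow> smooth_on S (\<lambda>x. L (F x))"
  unfolding smooth_on_def using Ck_on_bounded_linear by blast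

lemma smooth_on_add:
  "open S \<Longrightarrow> smooth_on S F \<Longrightarrow> smooth_on S G \<Longrightarrow> smooth_on S (\<lambda>x. F x + G x)"
  unfolding smooth_on_def using Ck_on_add by blast

lemma smooth_on_bounded_bilinear:
  "open S \<Longrightarrow> bounded_bilinear b \<Longrightarrow> smooth_on S F \<Longrightarrow> smooth_on S G
    \<Longrightarrow> smooth_on S (\<lambda>x. b (F x) (G x))"
  unfolding smooth_on_def using Ck_on_bounded_bilinear by blast

lemmas smooth_on_scaleR = smooth_on_bounded_bilinear[OF _ bounded_bilinear_scaleR]

lemmas smooth_on_mult = smooth_on_bounded_bilinear[OF _ bounded_bilinear_mult]

lemma smooth_on_minus: "open S \<Longrightarrow> smooth_on S F \<Longrightarrow> smooth_on S (\<lambda>x. - F x)"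
  by (rule smooth_on_bounded_linear[OF _ bounded_linear_minus[OF bounded_linear_ident]])

lemma smooth_on_diff:
  "open S \<Longrightarrow> smooth_on S F \<Longrightarrow> smooth_on S G \<Longrightarrow> smooth_on S (\<lambda>x. F x - G x)"
  using smooth_on_add[of S F "\<lambda>x. - G x"] smooth_on_minus[of S G] by simp

lemma smooth_on_sum:
  "open S \<Longrightarrow> (\<And>i. i \<in> I \<Longrightarrow> smooth_on S (F i)) \<Longrightarrow> smooth_on S (\<lambda>x. \<Sum>i\<in>I. F i x)"
  by (induction I rule: infinite_finite_induct) (auto intro: smooth_on_const smooth_on_add)

lemma smooth_on_prod:
  fixes F :: "'i \<Rightarrow> 'e::euclidean_space \<Rightarrow> real"
  shows "open S \<Longrightarrow> (\<And>i. i \<in> I \<Longrightarrow> smooth_on S (F i)) \<Longrightarrow> smooth_on S (\<lambda>x. \<Prod>i\<in>I. F i x)"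
  by (induction I rule: infinite_finite_induct) (auto intro: smooth_on_const smooth_on_mult)

lemma smooth_on_differentiable: "smooth_on S F \<Longrightarrow> u \<in> S \<Longrightarrow> F differentiable (at u)"
  unfolding smooth_on_def by (metis Ck_on.simps(2))

lemma smooth_on_dd: "smooth_on S F \<Longrightarrow> smooth_on S (\<lambda>x. dd F x v)"
  unfolding smooth_on_def by (metis Ck_on.simps(2))

lemma smooth_on_continuous: "smooth_on S F \<Longrightarrow> continuous_on S F"
  unfolding smooth_on_def by (metis Ck_on.simps(1))

lemma Ck_on_inverse:
  fixes F :: "'e::euclidean_space \<Rightarrow> real"
  assumes "open S" "\<And>x. x \<in> S \<Longrightarrow> F x \<noteq> 0" "Ck_on k S F"
  shows "Ck_on k S (\<lambda>x. inverse (F x))"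
  using assms(3)
proof (induction k)
  case 0
  then show ?case using assms(2) by (auto intro: continuous_on_inverse)
next
  case (Suc k)
  have d: "((\<lambda>x. inverse (F x)) has_derivative (\<lambda>v. - (inverse (F x) * dd F x v * inverse (F x)))) (at x)"
    if "x \<in> S" for x
    using Suc.prems that assms(2)[OF that] by (intro Deriv.has_derivative_inverse dd_works) auto
  have "Ck_on k S (\<lambda>x. dd (\<lambda>x. inverse (F x)) x v)" for v
  proof (rule Ck_on_cong[OF assms(1)])
    show "Ck_on k S (\<lambda>x. - (inverse (F x) * dd F x v * inverse (F x)))"
      using Suc.IH[OF Ck_on_Suc_imp[OF Suc.prems]] Suc.prems
      by (intro Ck_on_bounded_linear[OF assms(1) bounded_linear_minus[OF bounded_linear_ident]]
          Ck_on_bounded_bilinear[OF assms(1) bounded_bilinear_mult]) simp_all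
  qed (simp add: dd_eqI[OF d])
  moreover have "\<And>x. x \<in> S \<Longrightarrow> (\<lambda>x. inverse (F x)) differentiable (at x)"
    using d unfolding differentiable_def by blast
  ultimately show ?case by simp
qed

lemma smooth_on_inverse:
  fixes F :: "'e::euclidean_space \<Rightarrow> real"
  shows "open S \<Longrightarrow> (\<And>x. x \<in> S \<Longrightarrow> F x \<noteq> 0) \<Longrightarrow> smooth_on S F
    \<Longrightarrow> smooth_on S (\<lambda>x. inverse (F x))"
  unfolding smooth_on_def using Ck_on_inverse by blast

lemma linear_eq_sum_Basis:
  fixes L :: "'f::euclidean_space \<Rightarrow> 'g::real_vector"
  assumes "linear L"
  shows "L v = (\<Sum>b\<in>Basis. (v \<bullet> b) *\<^sub>R L b)"
proof -
  have "L v = L (\<Sum>b\<in>Basis. (v \<bullet> b) *\<^sub>R b)" by (simp add: euclidean_representation)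
  then show ?thesis by (simp add: linear_sum[OF assms] linear_cmul[OF assms])
qed

lemma dd_compose:
  assumes "F differentiable (at (G u))" "G differentiable (at u)"
  shows "dd (\<lambda>x. F (G x)) u v = dd F (G u) (dd G u v)"
  using dd_eqI[OF has_derivative_compose[OF dd_works[OF assms(2)] dd_works[OF assms(1)]]] .

text \<open>The derivative of the composite is a sum over the basis of
  \<open>dd G x v \<bullet> b\<close> times \<open>dd F (G x) b\<close>. With \<open>F\<close>
  smooth, its directional derivatives are again admissible outer maps for the induction hypothesis,
  so only the order of \<open>G\<close> has to be tracked.\<close>

lemma Ck_on_compose:
  fixes F :: "'f::euclidean_space \<Rightarrow> 'g::real_normed_vector" and G :: "'e::euclidean_space \<Rightarrow> 'f"
  assumes "open S" "G ` S \<subseteq> T" "smooth_on T F" "Ck_on k S G"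
  shows "Ck_on k S (\<lambda>x. F (G x))"
  using assms(3,4)
proof (induction k arbitrary: F)
  case 0
  then show ?case
    using continuous_on_compose2[OF smooth_on_continuous] assms(2) by auto
next
  case (Suc k)
  have F: "F differentiable (at (G x))" and G: "G differentiable (at x)" if "x \<in> S" for x
    using Suc.prems that assms(2) smooth_on_differentiable by (auto simp: image_subset_iff)
  have eq: "dd (\<lambda>x. F (G x)) x v = (\<Sum>b\<in>Basis. (dd G x v \<bullet> b) *\<^sub>R dd F (G x) b)" if "x \<in> S" for x v
    using dd_compose[OF F[OF that] G[OF that]] linear_eq_sum_Basis[OF linear_dd[OF F[OF that]]] by metis
  have s: "Ck_on k S (\<lambda>x. \<Sum>b\<in>I. (dd G x v \<bullet> b) *\<^sub>R dd F (G x) b)" for v and I :: "'f set"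
  proof (induction I rule: infinite_finite_induct)
    case (insert b I)
    have "Ck_on k S (\<lambda>x. dd F (G x) b)"
      using Suc.IH[of "\<lambda>x. dd F x b"] Suc.prems Ck_on_Suc_imp smooth_on_dd by blast
    moreover have "Ck_on k S (\<lambda>x. dd G x v \<bullet> b)"
      using Suc.prems by (intro Ck_on_bounded_linear[OF assms(1) bounded_linear_inner_left]) auto
    ultimately show ?case using insert
      by (auto intro!: Ck_on_add Ck_on_bounded_bilinear[OF _ bounded_bilinear_scaleR] assms)
  qed (auto simp: Ck_on_const)
  have "Ck_on k S (\<lambda>x. dd (\<lambda>x. F (G x)) x v)" for v
    by (rule Ck_on_cong[OF assms(1) _ s[where I = Basis]]) (simp add: eq)
  moreover have "(\<lambda>x. F (G x)) differentiable (at x)" if "x \<in> S" for x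
    using F[OF that] G[OF that] by (rule differentiable_compose)
  ultimately show ?case by simp
qed

lemma smooth_on_compose:
  fixes F :: "'f::euclidean_space \<Rightarrow> 'g::real_normed_vector" and G :: "'e::euclidean_space \<Rightarrow> 'f"
  shows "open S \<Longrightarrow> G ` S \<subseteq> T \<Longrightarrow> smooth_on T F \<Longrightarrow> smooth_on S G
    \<Longrightarrow> smooth_on S (\<lambda>x. F (G x))"
  using Ck_on_compose[of S G T F] unfolding smooth_on_def by blast

lemma smooth_on_vec_lambda:
  fixes F :: "'i::finite \<Rightarrow> 'e::euclidean_space \<Rightarrow> real"
  assumes "open S" "\<And>i. smooth_on S (F i)"
  shows "smooth_on S (\<lambda>x. \<chi> i. F i x)"
proof -
  have "(\<chi> i. F i x) = (\<Sum>i\<in>UNIV. F i x *\<^sub>R axis i 1)" for x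
    by (simp add: vec_eq_iff axis_def if_distrib[of "(*) _"] cong: if_cong)
  moreover have "smooth_on S (\<lambda>x. \<Sum>i\<in>UNIV. F i x *\<^sub>R (axis i 1 :: real ^ 'i))"
    by (intro smooth_on_sum smooth_on_scaleR smooth_on_const assms)
  ultimately show ?thesis by simp
qed

section \<open>Symmetry of second derivatives\<close>

lemma mvt_line:
  fixes F :: "'e::euclidean_space \<Rightarrow> real"
  assumes "0 < t" "\<And>s. 0 \<le> s \<Longrightarrow> s \<le> t \<Longrightarrow> F differentiable (at (p + s *\<^sub>R u))"
  shows "\<exists>\<theta>. 0 < \<theta> \<and> \<theta> < t \<and> F (p + t *\<^sub>R u) - F p = t * dd F (p + \<theta> *\<^sub>R u) u"
proof -
  have "((\<lambda>s. F (p + s *\<^sub>R u)) has_real_derivative dd F (p + s *\<^sub>R u) u) (at s)"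
    if "0 \<le> s" "s \<le> t" for s
  proof -
    have "((\<lambda>s. F (p + s *\<^sub>R u)) has_derivative (\<lambda>r. dd F (p + s *\<^sub>R u) (r *\<^sub>R u))) (at s)"
      using dd_works[OF assms(2)[OF that]]
      by (intro has_derivative_compose[of "\<lambda>s. p + s *\<^sub>R u" "\<lambda>r. r *\<^sub>R u" _ UNIV F])
        (auto intro!: derivative_eq_intros)
    moreover have "dd F (p + s *\<^sub>R u) (r *\<^sub>R u) = dd F (p + s *\<^sub>R u) u * r" for r
      using linear_cmul[OF linear_dd[OF assms(2)[OF that]]] by simp
    ultimately show ?thesis by (simp add: has_field_derivative_def mult_commute_abs)
  qed
  from MVT2[OF assms(1) this] show ?thesis by force
qed

text \<open>The second difference of \<open>F\<close> over a small parallelogram does not depend on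
  the order of the sides. Two mean value steps write it as \<open>t * t\<close> times either mixed
  derivative at a point close to \<open>x\<close>; continuity then forces both to agree at
  \<open>x\<close>.\<close>

lemma second_derivative_symmetric_real:
  fixes F :: "'e::euclidean_space \<Rightarrow> real"
  assumes "open S" "smooth_on S F" "x \<in> S"
  shows "dd (\<lambda>s. dd F s u) x v = dd (\<lambda>s. dd F s v) x u"
proof -
  obtain e where e: "0 < e" "ball x e \<subseteq> S"
    using assms openE by blast
  have dist_add: "dist x (x + w) = norm w" for w by (simp add: dist_norm)
  have quotient: "\<exists>p. dist x p \<le> t * (norm u + norm v) \<and>
      F (x + t *\<^sub>R u + t *\<^sub>R v) - F (x + t *\<^sub>R u) - F (x + t *\<^sub>R v) + F x
        = t * t * dd (\<lambda>s. dd F s u) p v"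
    if t: "0 < t" "t * (norm u + norm v) < e" for t u v
  proof -
    have inS: "x + a *\<^sub>R u + b *\<^sub>R v \<in> S" if "0 \<le> a" "a \<le> t" "0 \<le> b" "b \<le> t" for a b
    proof -
      have "norm (a *\<^sub>R u + b *\<^sub>R v) \<le> a * norm u + b * norm v"
        using norm_triangle_ineq[of "a *\<^sub>R u" "b *\<^sub>R v"] that by simp
      also have "\<dots> \<le> t * norm u + t * norm v"
        using that by (intro add_mono mult_right_mono) auto
      finally have "dist x (x + a *\<^sub>R u + b *\<^sub>R v) < e"
        using t(2) by (simp add: dist_add distrib_left add.assoc)
      then show ?thesis using e by auto
    qed
    have dF: "F differentiable (at y)" if "y \<in> S" for y
      using assms(2) that by (rule smooth_on_differentiable)
    \<comment> \<open>The second difference is the increment of \<open>G\<close> along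
      \<open>u\<close>; the outer mean value step runs along \<open>u\<close>, the inner one along
      \<open>v\<close>.\<close>
    define G where "G = (\<lambda>p. F (p + t *\<^sub>R v) - F p)"
    have G: "(G has_derivative (\<lambda>w. dd F (x + s *\<^sub>R u + t *\<^sub>R v) w - dd F (x + s *\<^sub>R u) w)) (at (x + s *\<^sub>R u))"
      if "0 \<le> s" "s \<le> t" for s
      unfolding G_def using inS[of s t] inS[of s 0] that t
      by (intro has_derivative_diff dd_works dF
          has_derivative_compose[of "\<lambda>p. p + t *\<^sub>R v" "\<lambda>w. w" _ UNIV F])
        (auto intro!: derivative_eq_intros dd_works dF)
    obtain \<theta> where \<theta>: "0 < \<theta>" "\<theta> < t" "G (x + t *\<^sub>R u) - G x = t * dd G (x + \<theta> *\<^sub>R u) u"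
      using mvt_line[OF t(1), of G x u] G unfolding differentiable_def by blast
    have "(\<lambda>s. dd F s u) differentiable (at (x + \<theta> *\<^sub>R u + s *\<^sub>R v))" if "0 \<le> s" "s \<le> t" for s
      using smooth_on_differentiable[OF smooth_on_dd[OF assms(2)]] inS[of \<theta> s] \<theta> that by simp
    from mvt_line[OF t(1), OF this] obtain \<theta>' where \<theta>': "0 < \<theta>'" "\<theta>' < t"
      "dd F (x + \<theta> *\<^sub>R u + t *\<^sub>R v) u - dd F (x + \<theta> *\<^sub>R u) u
        = t * dd (\<lambda>s. dd F s u) (x + \<theta> *\<^sub>R u + \<theta>' *\<^sub>R v) v"
      by blast
    have "dd G (x + \<theta> *\<^sub>R u) u = t * dd (\<lambda>s. dd F s u) (x + \<theta> *\<^sub>R u + \<theta>' *\<^sub>R v) v"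
      using dd_eqI[OF G[of \<theta>]] \<theta> \<theta>'(3) by simp
    then have "G (x + t *\<^sub>R u) - G x = t * t * dd (\<lambda>s. dd F s u) (x + \<theta> *\<^sub>R u + \<theta>' *\<^sub>R v) v"
      using \<theta>(3) by simp
    moreover have "dist x (x + \<theta> *\<^sub>R u + \<theta>' *\<^sub>R v) \<le> t * (norm u + norm v)"
    proof -
      have "norm (\<theta> *\<^sub>R u + \<theta>' *\<^sub>R v) \<le> \<theta> * norm u + \<theta>' * norm v"
        using norm_triangle_ineq[of "\<theta> *\<^sub>R u" "\<theta>' *\<^sub>R v"] \<theta> \<theta>' by simp
      also have "\<dots> \<le> t * norm u + t * norm v"
        using \<theta> \<theta>' by (intro add_mono mult_right_mono) auto
      finally show ?thesis
        by (simp add: dist_add distrib_left add.assoc)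
    qed
    ultimately show ?thesis unfolding G_def by (intro exI conjI) (auto simp: algebra_simps)
  qed
  have cont: "isCont (\<lambda>p. dd (\<lambda>s. dd F s u) p v) x" for u v
    using smooth_on_continuous[OF smooth_on_dd[OF smooth_on_dd[OF assms(2)]]]
      continuous_on_eq_continuous_at[OF assms(1)] assms(3) by blast
  show ?thesis
  proof (rule ccontr)
    assume ne: "\<not> ?thesis"
    \<comment> \<open>Half the distance of the two mixed derivatives: no common value can then be
      closer than \<open>\<epsilon>\<close> to both.\<close>
    define \<epsilon> where "\<epsilon> = dist (dd (\<lambda>s. dd F s u) x v) (dd (\<lambda>s. dd F s v) x u) / 2"
    have "0 < \<epsilon>" using ne by (simp add: \<epsilon>_def)
    obtain d1 where d1: "0 < d1"
      "\<And>p. dist p x < d1 \<Longrightarrow> dist (dd (\<lambda>s. dd F s u) p v) (dd (\<lambda>s. dd F s u) x v) < \<epsilon>"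
      using cont[of u v] \<open>0 < \<epsilon>\<close> unfolding continuous_at_eps_delta by blast
    obtain d2 where d2: "0 < d2"
      "\<And>p. dist p x < d2 \<Longrightarrow> dist (dd (\<lambda>s. dd F s v) p u) (dd (\<lambda>s. dd F s v) x u) < \<epsilon>"
      using cont[of v u] \<open>0 < \<epsilon>\<close> unfolding continuous_at_eps_delta by blast
    define \<delta> where "\<delta> = min e (min d1 d2)"
    \<comment> \<open>The summand 1 keeps \<open>N\<close> positive when \<open>u\<close> and
      \<open>v\<close> vanish; the factor 2 in \<open>t\<close> makes the bound by
      \<open>\<delta>\<close> strict.\<close>
    define N where "N = norm u + norm v + 1"
    define t where "t = \<delta> / (2 * N)"
    have "0 < N" unfolding N_def using norm_ge_zero[of u] norm_ge_zero[of v] by linarith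
    have "0 < \<delta>" using e d1 d2 by (simp add: \<delta>_def)
    have "0 < t" unfolding t_def using \<open>0 < \<delta>\<close> \<open>0 < N\<close> by simp
    have "t * (norm u + norm v) \<le> t * N" unfolding N_def using \<open>0 < t\<close> by (intro mult_left_mono) auto
    also have "\<dots> < \<delta>" unfolding t_def using \<open>0 < \<delta>\<close> \<open>0 < N\<close> by simp
    finally have lt: "t * (norm u + norm v) < \<delta>" .
    obtain p where p: "dist x p \<le> t * (norm u + norm v)"
      "F (x + t *\<^sub>R u + t *\<^sub>R v) - F (x + t *\<^sub>R u) - F (x + t *\<^sub>R v) + F x = t * t * dd (\<lambda>s. dd F s u) p v"
      using quotient[of t u v] \<open>0 < t\<close> lt by (auto simp: \<delta>_def)
    obtain q where q: "dist x q \<le> t * (norm v + norm u)"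
      "F (x + t *\<^sub>R v + t *\<^sub>R u) - F (x + t *\<^sub>R v) - F (x + t *\<^sub>R u) + F x = t * t * dd (\<lambda>s. dd F s v) q u"
      using quotient[of t v u] \<open>0 < t\<close> lt by (auto simp: \<delta>_def add.commute)
    have e: "x + t *\<^sub>R v + t *\<^sub>R u = x + t *\<^sub>R u + t *\<^sub>R v" by (simp add: algebra_simps)
    have "t * t * dd (\<lambda>s. dd F s u) p v = t * t * dd (\<lambda>s. dd F s v) q u"
      using p(2) q(2) unfolding e by linarith
    then have "dd (\<lambda>s. dd F s u) p v = dd (\<lambda>s. dd F s v) q u" using \<open>0 < t\<close> by simp
    moreover have "dist (dd (\<lambda>s. dd F s u) p v) (dd (\<lambda>s. dd F s u) x v) < \<epsilon>"
      using p(1) lt by (intro d1) (simp add: \<delta>_def dist_commute)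
    moreover have "dist (dd (\<lambda>s. dd F s v) q u) (dd (\<lambda>s. dd F s v) x u) < \<epsilon>"
      using q(1) lt by (intro d2) (simp add: \<delta>_def dist_commute add.commute)
    ultimately show False
      using dist_triangle_half_r unfolding \<epsilon>_def by (metis order_less_irrefl)
  qed
qed

lemma dd_bounded_linear:
  "bounded_linear L \<Longrightarrow> F differentiable (at u) \<Longrightarrow> dd (\<lambda>s. L (F s)) u v = L (dd F u v)"
  by (rule dd_eqI) (rule bounded_linear.has_derivative[OF _ dd_works])

lemma second_derivative_symmetric:
  fixes F :: "'e::euclidean_space \<Rightarrow> 'f::euclidean_space"
  assumes "open S" "smooth_on S F" "x \<in> S"
  shows "dd (\<lambda>s. dd F s u) x v = dd (\<lambda>s. dd F s v) x u"
proof (rule euclidean_eqI)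
  fix b :: 'f assume "b \<in> Basis"
  have L: "bounded_linear (\<lambda>z. z \<bullet> b)" by (rule bounded_linear_inner_left)
  have "dd (\<lambda>s. dd F s u) x v \<bullet> b = dd (\<lambda>s. dd (\<lambda>s. F s \<bullet> b) s u) x v" for u v
  proof -
    have "dd (\<lambda>s. dd F s u) x v \<bullet> b = dd (\<lambda>s. dd F s u \<bullet> b) x v"
      using dd_bounded_linear[OF L smooth_on_differentiable[OF smooth_on_dd[OF assms(2)] assms(3)]] by simp
    also have "\<dots> = dd (\<lambda>s. dd (\<lambda>s. F s \<bullet> b) s u) x v"
      by (rule dd_cong[OF assms(1,3)])
        (simp add: dd_bounded_linear[OF L smooth_on_differentiable[OF assms(2)]])
    finally show ?thesis .
  qed
  then show "dd (\<lambda>s. dd F s u) x v \<bullet> b = dd (\<lambda>s. dd F s v) x u \<bullet> b"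
    using second_derivative_symmetric_real[OF assms(1) smooth_on_bounded_linear[OF assms(1) L assms(2)] assms(3)]
    by simp
qed

section \<open>Metrics and the Levi-Civita connection in a chart\<close>

text \<open>Fields of linear maps keep the curried form of \<open>endo_field\<close>, smooth for
  every fixed argument. Expanding a variable argument in the basis recovers smoothness of the
  applied field.\<close>

definition smooth_lin :: "'e::euclidean_space set \<Rightarrow> ('e \<Rightarrow> 'f::euclidean_space \<Rightarrow> 'g::real_normed_vector) \<Rightarrow> bool" where
  "smooth_lin S L \<longleftrightarrow> (\<forall>s\<in>S. linear (L s)) \<and> (\<forall>v. smooth_on S (\<lambda>s. L s v))"

definition smooth_bil ::
  "'e::euclidean_space set \<Rightarrow> ('e \<Rightarrow> 'f::euclidean_space \<Rightarrow> 'f \<Rightarrow> 'g::real_normed_vector) \<Rightarrow> bool" where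
  "smooth_bil S b \<longleftrightarrow> (\<forall>s\<in>S. bilinear (b s)) \<and> (\<forall>v w. smooth_on S (\<lambda>s. b s v w))"

lemma smooth_lin_apply:
  assumes "open S" "smooth_lin S L" "smooth_on S V"
  shows "smooth_on S (\<lambda>s. L s (V s))"
proof (rule smooth_on_cong[OF assms(1)])
  show "smooth_on S (\<lambda>s. \<Sum>b\<in>Basis. (V s \<bullet> b) *\<^sub>R L s b)"
    using assms unfolding smooth_lin_def
    by (intro smooth_on_sum smooth_on_scaleR smooth_on_bounded_linear[OF _ bounded_linear_inner_left]) auto
  show "(\<Sum>b\<in>Basis. (V s \<bullet> b) *\<^sub>R L s b) = L s (V s)" if "s \<in> S" for s
    using assms(2) that linear_eq_sum_Basis[of "L s" "V s"] unfolding smooth_lin_def by metis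
qed

text \<open>\<open>L s\<close> is a bare function, linear only for \<open>s\<close> in
  \<open>S\<close>; expanding \<open>V s\<close> in the basis reduces the claim to the product rule
  for scalars. The first term freezes the argument, which matches the extension of vectors with
  constant components.\<close>

lemma dd_lin:
  fixes L :: "'e::euclidean_space \<Rightarrow> 'f::euclidean_space \<Rightarrow> 'g::real_normed_vector" and V :: "'e \<Rightarrow> 'f"
  assumes "open S" "u \<in> S" "\<And>s. s \<in> S \<Longrightarrow> linear (L s)"
    and "\<And>v. (\<lambda>s. L s v) differentiable (at u)" "V differentiable (at u)"
  shows "dd (\<lambda>s. L s (V s)) u x = dd (\<lambda>s. L s (V u)) u x + L u (dd V u x)" (is ?eq)
    and "(\<lambda>s. L s (V s)) differentiable (at u)" (is ?diff)
proof -
  have V: "((\<lambda>s. V s \<bullet> b) has_derivative (\<lambda>x. dd V u x \<bullet> b)) (at u)" for b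
    using bounded_linear.has_derivative[OF bounded_linear_inner_left dd_works[OF assms(5)]] .
  have "((\<lambda>s. \<Sum>b\<in>Basis. (V s \<bullet> b) *\<^sub>R L s b) has_derivative
      (\<lambda>x. \<Sum>b\<in>Basis. (V u \<bullet> b) *\<^sub>R dd (\<lambda>s. L s b) u x + (dd V u x \<bullet> b) *\<^sub>R L u b)) (at u)"
    by (intro has_derivative_sum has_derivative_scaleR V dd_works assms)
  then have d: "((\<lambda>s. L s (V s)) has_derivative
      (\<lambda>x. \<Sum>b\<in>Basis. (V u \<bullet> b) *\<^sub>R dd (\<lambda>s. L s b) u x + (dd V u x \<bullet> b) *\<^sub>R L u b)) (at u)"
    by (rule has_derivative_transform_within_open[OF _ assms(1,2)])
      (rule linear_eq_sum_Basis[OF assms(3), symmetric])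
  then show ?diff unfolding differentiable_def by blast
  have "((\<lambda>s. \<Sum>b\<in>Basis. (V u \<bullet> b) *\<^sub>R L s b) has_derivative
      (\<lambda>x. \<Sum>b\<in>Basis. (V u \<bullet> b) *\<^sub>R dd (\<lambda>s. L s b) u x)) (at u)"
    by (intro has_derivative_sum bounded_linear.has_derivative[OF bounded_linear_scaleR_right] dd_works assms)
  then have "((\<lambda>s. L s (V u)) has_derivative
      (\<lambda>x. \<Sum>b\<in>Basis. (V u \<bullet> b) *\<^sub>R dd (\<lambda>s. L s b) u x)) (at u)"
    by (rule has_derivative_transform_within_open[OF _ assms(1,2)])
      (rule linear_eq_sum_Basis[OF assms(3), symmetric])
  then have "dd (\<lambda>s. L s (V u)) u x = (\<Sum>b\<in>Basis. (V u \<bullet> b) *\<^sub>R dd (\<lambda>s. L s b) u x)"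
    by (rule dd_eqI)
  moreover have "L u (dd V u x) = (\<Sum>b\<in>Basis. (dd V u x \<bullet> b) *\<^sub>R L u b)"
    by (rule linear_eq_sum_Basis[OF assms(3)[OF assms(2)]])
  ultimately show ?eq using dd_eqI[OF d, of x] by (simp add: sum.distrib)
qed

lemma smooth_lin_dd:
  assumes "open S" "u \<in> S" "smooth_lin S L" "V differentiable (at u)"
  shows "dd (\<lambda>s. L s (V s)) u x = dd (\<lambda>s. L s (V u)) u x + L u (dd V u x)"
    and "(\<lambda>s. L s (V s)) differentiable (at u)"
  using dd_lin[OF assms(1,2) _ _ assms(4), of L] assms smooth_on_differentiable
  unfolding smooth_lin_def by blast+

lemma dd_add: "F differentiable (at u) \<Longrightarrow> G differentiable (at u)
    \<Longrightarrow> dd (\<lambda>s. F s + G s) u x = dd F u x + dd G u x"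
  by (rule dd_eqI) (intro has_derivative_add dd_works)

lemma dd_diff: "F differentiable (at u) \<Longrightarrow> G differentiable (at u)
    \<Longrightarrow> dd (\<lambda>s. F s - G s) u x = dd F u x - dd G u x"
  by (rule dd_eqI) (intro has_derivative_diff dd_works)

lemma dd_scaleR: "F differentiable (at u) \<Longrightarrow> G differentiable (at u)
    \<Longrightarrow> dd (\<lambda>s. F s *\<^sub>R G s) u x = F u *\<^sub>R dd G u x + dd F u x *\<^sub>R G u"
  by (rule dd_eqI) (intro has_derivative_scaleR dd_works)

lemma linear_dd_param:
  assumes "open S" "u \<in> S" "smooth_lin S L"
  shows "linear (\<lambda>v. dd (\<lambda>s. L s v) u x)"
proof (rule linearI)
  have d: "(\<lambda>s. L s v) differentiable (at u)" for v
    using assms smooth_on_differentiable unfolding smooth_lin_def by blast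
  show "dd (\<lambda>s. L s (v + w)) u x = dd (\<lambda>s. L s v) u x + dd (\<lambda>s. L s w) u x" for v w
    using dd_cong[OF assms(1,2), of "\<lambda>s. L s (v + w)" "\<lambda>s. L s v + L s w"] assms(3)
    by (simp add: dd_add[OF d d] smooth_lin_def linear_add)
  show "dd (\<lambda>s. L s (a *\<^sub>R v)) u x = a *\<^sub>R dd (\<lambda>s. L s v) u x" for a v
    using dd_cong[OF assms(1,2), of "\<lambda>s. L s (a *\<^sub>R v)" "\<lambda>s. a *\<^sub>R L s v"] assms(3)
    by (simp add: dd_bounded_linear[OF bounded_linear_scaleR_right d] smooth_lin_def linear_cmul)
qed

lemma bilinearD:
  assumes "bilinear b"
  shows "linear (b v)" "linear (\<lambda>v. b v w)"
  using assms unfolding bilinear_def by auto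

lemma bilinear_simps:
  assumes "bilinear b"
  shows "b (v + v') w = b v w + b v' w" "b v (w + w') = b v w + b v w'"
    "b (v - v') w = b v w - b v' w" "b v (w - w') = b v w - b v w'"
    "b (a *\<^sub>R v) w = a *\<^sub>R b v w" "b v (a *\<^sub>R w) = a *\<^sub>R b v w"
    "b (- v) w = - b v w" "b v (- w) = - b v w" "b 0 w = 0" "b v 0 = 0"
  using assms
  by (simp_all add: bilinear_ladd bilinear_radd bilinear_lsub bilinear_rsub bilinear_lmul bilinear_rmul
      bilinear_lneg bilinear_rneg bilinear_lzero bilinear_rzero)

lemma smooth_bil_lin:
  assumes "smooth_bil S b"
  shows "smooth_lin S (\<lambda>s. b s v)" "smooth_lin S (\<lambda>s v. b s v w)"
  using assms unfolding smooth_bil_def smooth_lin_def by (auto dest: bilinearD)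

lemma smooth_bil_apply:
  assumes "open S" "smooth_bil S b" "smooth_on S V" "smooth_on S W"
  shows "smooth_on S (\<lambda>s. b s (V s) (W s))"
proof -
  have "smooth_on S (\<lambda>s. b s (V s) w)" for w
    using smooth_lin_apply[OF assms(1) smooth_bil_lin(2)[OF assms(2)] assms(3)] .
  then have "smooth_lin S (\<lambda>s. b s (V s))"
    using assms(2) unfolding smooth_bil_def smooth_lin_def by (auto dest: bilinearD)
  from smooth_lin_apply[OF assms(1) this assms(4)] show ?thesis .
qed

lemma smooth_bil_dd:
  assumes "open S" "u \<in> S" "smooth_bil S b" "V differentiable (at u)" "W differentiable (at u)"
  shows "dd (\<lambda>s. b s (V s) (W s)) u x
      = dd (\<lambda>s. b s (V u) (W u)) u x + b u (dd V u x) (W u) + b u (V u) (dd W u x)"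
    and "(\<lambda>s. b s (V s) (W s)) differentiable (at u)"
proof -
  have d: "(\<lambda>s. b s (V s) w) differentiable (at u)" for w
    using smooth_lin_dd(2)[OF assms(1,2) smooth_bil_lin(2)[OF assms(3)] assms(4)] .
  have l: "linear (b s (V s))" if "s \<in> S" for s
    using assms(3) that unfolding smooth_bil_def by (auto dest: bilinearD)
  note * = dd_lin[OF assms(1,2) l d assms(5)]
  show "(\<lambda>s. b s (V s) (W s)) differentiable (at u)" by (rule *(2))
  have "dd (\<lambda>s. b s (V s) (W s)) u x = dd (\<lambda>s. b s (V s) (W u)) u x + b u (V u) (dd W u x)"
    by (rule *(1))
  then show "dd (\<lambda>s. b s (V s) (W s)) u x
      = dd (\<lambda>s. b s (V u) (W u)) u x + b u (dd V u x) (W u) + b u (V u) (dd W u x)"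
    using smooth_lin_dd(1)[OF assms(1,2) smooth_bil_lin(2)[OF assms(3)] assms(4)] by simp
qed

lemma linear_axis_sum:
  fixes v :: "real ^ 'm::finite"
  assumes "linear L"
  shows "L v = (\<Sum>i\<in>UNIV. v $ i *\<^sub>R L (axis i 1))"
proof -
  have "v = (\<Sum>i\<in>UNIV. v $ i *\<^sub>R axis i 1)"
    by (simp add: vec_eq_iff axis_def if_distrib[of "(*) _"] cong: if_cong)
  from arg_cong[OF this, of L] show ?thesis
    by (simp add: linear_sum[OF assms] linear_cmul[OF assms])
qed

text \<open>The domain is a parameter because the same metric is used on a full coordinate image and
  on the smaller open set \<open>repdom\<close> where an immersion is represented.\<close>

definition metric_on :: "(real ^ 'm) set \<Rightarrow> 'm::finite lmetric \<Rightarrow> bool" where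
  "metric_on S h \<longleftrightarrow> open S \<and> smooth_bil S h \<and>
     (\<forall>u\<in>S. (\<forall>v w. h u v w = h u w v) \<and> (\<forall>v. v \<noteq> 0 \<longrightarrow> 0 < h u v v))"

locale metric_chart =
  fixes S :: "(real ^ 'm::finite) set" and h :: "'m lmetric"
  assumes metric: "metric_on S h"
begin

lemma open_S: "open S"
  and smooth_h: "smooth_bil S h"
  and bil: "u \<in> S \<Longrightarrow> bilinear (h u)"
  and sym: "u \<in> S \<Longrightarrow> h u v w = h u w v"
  and pos: "u \<in> S \<Longrightarrow> v \<noteq> 0 \<Longrightarrow> 0 < h u v v"
  using metric by (simp_all add: metric_on_def smooth_bil_def)

definition gram :: "real ^ 'm \<Rightarrow> real ^ 'm ^ 'm" where
  "gram u = (\<chi> i j. h u (axis i 1) (axis j 1))"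

lemma gram_mult: "u \<in> S \<Longrightarrow> (gram u *v z) $ i = h u (axis i 1) z"
proof -
  assume u: "u \<in> S"
  have "h u (axis i 1) z = (\<Sum>j\<in>UNIV. z $ j * h u (axis i 1) (axis j 1))"
    using linear_axis_sum[OF bilinearD(1)[OF bil[OF u]], where v = z] by simp
  then show ?thesis by (simp add: gram_def matrix_vector_mult_def mult.commute)
qed

text \<open>Test with \<open>z = v - w\<close>. The symmetry and bilinearity of
  \<open>christoffel\<close> are proved through this, by pairing with every
  \<open>z\<close>.\<close>

lemma nondegenerate: "u \<in> S \<Longrightarrow> (\<And>z. h u v z = h u w z) \<Longrightarrow> v = w"
  using pos[of u "v - w"] bilinear_simps(3)[OF bil[of u], of v w "v - w"] by force

lemma invertible_gram: "u \<in> S \<Longrightarrow> invertible (gram u)"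
proof -
  assume u: "u \<in> S"
  have "z = 0" if "gram u *v z = 0" for z
  proof (rule nondegenerate[OF u])
    fix y
    have "h u (axis i 1) z = 0" for i using gram_mult[OF u, of z i] that by simp
    moreover have "h u y z = (\<Sum>i\<in>UNIV. y $ i * h u (axis i 1) z)"
      using linear_axis_sum[OF bilinearD(2)[OF bil[OF u]], where v = y] by simp
    ultimately show "h u z y = h u 0 y" using sym[OF u, of z y] bilinear_simps(9)[OF bil[OF u]] by simp
  qed
  then show ?thesis
    using matrix_left_invertible_ker invertible_left_inverse by blast
qed

lemma gram_inv_eq: "gram_inv h u = matrix_inv (gram u)"
  unfolding gram_inv_def gram_def ..

lemma gram_inv_mult:
  assumes "u \<in> S" shows "gram u ** gram_inv h u = mat 1" "gram_inv h u ** gram u = mat 1"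
  using someI_ex[OF invertible_gram[OF assms, unfolded invertible_def]]
  unfolding gram_inv_eq matrix_inv_def by blast+

lemma det_gram: "u \<in> S \<Longrightarrow> det (gram u) \<noteq> 0"
  using invertible_gram invertible_det_nz by blast

lemma smooth_gram_inv: "smooth_on S (\<lambda>u. gram_inv h u $ i $ j)"
proof (rule smooth_on_cong[OF open_S])
  \<comment> \<open>Cramer's rule: column \<open>i\<close> is replaced by the \<open>j\<close>-th
    unit vector. Determinants are polynomials in the smooth entries, so the quotient is
    smooth.\<close>
  let ?A = "\<lambda>u. \<chi> k l. if l = i then (axis j 1 :: real ^ 'm) $ k else gram u $ k $ l"
  show "smooth_on S (\<lambda>u. det (?A u) * inverse (det (gram u)))"
  proof (intro smooth_on_mult smooth_on_inverse open_S det_gram)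
    have 1: "smooth_on S (\<lambda>u. gram u $ k $ l)" for k l
      using smooth_h by (simp add: gram_def smooth_bil_def)
    then have 2: "smooth_on S (\<lambda>u. ?A u $ k $ l)" for k l
      by (cases "l = i") (simp_all add: smooth_on_const)
    show "smooth_on S (\<lambda>u. det (?A u))"
      unfolding det_def by (intro smooth_on_sum smooth_on_mult smooth_on_prod smooth_on_const open_S 2)
    show "smooth_on S (\<lambda>u. det (gram u))"
      unfolding det_def by (intro smooth_on_sum smooth_on_mult smooth_on_prod smooth_on_const open_S 1)
  qed
  show "det (?A u) * inverse (det (gram u)) = gram_inv h u $ i $ j" if u: "u \<in> S" for u
  proof -
    have "gram u *v (gram_inv h u *v axis j 1) = axis j 1"
      by (simp add: matrix_vector_mul_assoc gram_inv_mult[OF u])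
    then have "gram_inv h u *v axis j 1 = (\<chi> k. det (\<chi> k' l. if l = k then (axis j 1 :: real ^ 'm) $ k' else gram u $ k' $ l) / det (gram u))"
      using cramer[OF det_gram[OF u], of "gram_inv h u *v axis j 1" "axis j 1"] by simp
    moreover have "(gram_inv h u *v axis j 1) $ i = gram_inv h u $ i $ j"
      by (simp add: matrix_vector_mul_component inner_axis)
    ultimately show ?thesis by (simp add: divide_inverse)
  qed
qed

lemma dh_bil:
  assumes "u \<in> S"
  shows "linear (\<lambda>v. dd (\<lambda>s. h s v w) u x)" "linear (\<lambda>w. dd (\<lambda>s. h s v w) u x)"
    "linear (\<lambda>x. dd (\<lambda>s. h s v w) u x)"
  using linear_dd_param[OF open_S assms smooth_bil_lin(1)[OF smooth_h]]
    linear_dd_param[OF open_S assms smooth_bil_lin(2)[OF smooth_h]]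
    smooth_h linear_dd[OF smooth_on_differentiable[OF _ assms]] unfolding smooth_bil_def by blast+

text \<open>Raising an index gives the vector that represents \<open>L\<close> through the metric.
  It serves to read Koszul's formula off the definition of \<open>christoffel\<close> and to
  represent a linear form in \<open>mtrace_square_nonneg\<close>.\<close>

lemma gram_inv_raise:
  assumes "u \<in> S" "linear L"
  shows "h u (\<chi> k. \<Sum>l\<in>UNIV. gram_inv h u $ k $ l * L (axis l 1)) z = L z"
proof -
  let ?L = "\<chi> l. L (axis l 1)"
  let ?v = "gram_inv h u *v ?L"
  have "gram u *v ?v = ?L"
    by (simp add: matrix_vector_mul_assoc gram_inv_mult[OF assms(1)])
  then have "h u (axis i 1) ?v = L (axis i 1)" for i
    using gram_mult[OF assms(1), of ?v i] by simp
  moreover have "h u z ?v = (\<Sum>i\<in>UNIV. z $ i * h u (axis i 1) ?v)"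
    using linear_axis_sum[OF bilinearD(2)[OF bil[OF assms(1)]], where v = z] by simp
  moreover have "L z = (\<Sum>i\<in>UNIV. z $ i * L (axis i 1))"
    using linear_axis_sum[OF assms(2), where v = z] by simp
  ultimately have "h u z ?v = L z" by simp
  then show ?thesis using sym[OF assms(1)] by (simp add: matrix_vector_mult_def)
qed

lemma koszul:
  assumes "u \<in> S"
  shows "h u (christoffel h u v w) z =
    (dd (\<lambda>s. h s w z) u v + dd (\<lambda>s. h s v z) u w - dd (\<lambda>s. h s v w) u z) / 2"
proof -
  have "linear (\<lambda>z. (dd (\<lambda>s. h s w z) u v + dd (\<lambda>s. h s v z) u w - dd (\<lambda>s. h s v w) u z) / 2)"
    by (rule linearI)
      (simp_all add: linear_add[OF dh_bil(2)[OF assms]] linear_add[OF dh_bil(3)[OF assms]]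
        linear_cmul[OF dh_bil(2)[OF assms]] linear_cmul[OF dh_bil(3)[OF assms]] field_simps)
  from gram_inv_raise[OF assms this] show ?thesis unfolding christoffel_def by simp
qed

lemma christoffel_sym: "u \<in> S \<Longrightarrow> christoffel h u v w = christoffel h u w v"
proof (rule nondegenerate)
  assume u: "u \<in> S"
  have "dd (\<lambda>s. h s v w) u z = dd (\<lambda>s. h s w v) u z" for z
    by (rule dd_cong[OF open_S u]) (rule sym)
  then show "h u (christoffel h u v w) z = h u (christoffel h u w v) z" for z
    by (simp add: koszul[OF u])
qed

text \<open>In the sum of the two Koszul formulas the terms differentiated along \<open>v\<close>
  and \<open>w\<close> cancel.\<close>

lemma metric_compat:
  assumes "u \<in> S"
  shows "dd (\<lambda>s. h s v w) u x = h u (christoffel h u x v) w + h u v (christoffel h u x w)"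
proof -
  have "dd (\<lambda>s. h s w v) u x = dd (\<lambda>s. h s v w) u x"
    by (rule dd_cong[OF open_S assms]) (rule sym)
  then show ?thesis unfolding sym[OF assms, of v] koszul[OF assms] by (simp add: field_simps)
qed

lemma bilinear_christoffel: "u \<in> S \<Longrightarrow> bilinear (christoffel h u)"
proof -
  assume u: "u \<in> S"
  have l: "linear (christoffel h u v)" for v
    by (rule linearI; rule nondegenerate[OF u])
      (simp_all only: koszul[OF u] bilinear_simps[OF bil[OF u]]
        linear_add[OF dh_bil(1)[OF u]] linear_add[OF dh_bil(2)[OF u]] linear_add[OF dh_bil(3)[OF u]]
        linear_cmul[OF dh_bil(1)[OF u]] linear_cmul[OF dh_bil(2)[OF u]] linear_cmul[OF dh_bil(3)[OF u]]
        real_scaleR_def, simp_all add: field_simps)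
  moreover have "(\<lambda>v. christoffel h u v w) = christoffel h u w" for w
    using christoffel_sym[OF u] by auto
  ultimately show ?thesis unfolding bilinear_def by simp
qed

lemma smooth_christoffel: "smooth_bil S (christoffel h)"
proof -
  have "smooth_on S (\<lambda>s. christoffel h s v w)" for v w
    unfolding christoffel_def divide_inverse using smooth_h unfolding smooth_bil_def
    by (intro smooth_on_vec_lambda smooth_on_sum smooth_on_mult smooth_on_diff smooth_on_add
        smooth_on_dd smooth_gram_inv open_S smooth_on_const) auto
  then show ?thesis using bilinear_christoffel unfolding smooth_bil_def by blast
qed

end

section \<open>Symmetries of the curvature tensor\<close>

context metric_chart
begin

abbreviation D :: "real ^ 'm \<Rightarrow> 'm lvec \<Rightarrow> 'm lvec" where
  "D x Z \<equiv> nabla h (\<lambda>_. x) Z"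

lemma nabla_const: "nabla h (\<lambda>_. x) (\<lambda>_. y) = (\<lambda>s. christoffel h s x y)"
  by (simp add: nabla_def fun_eq_iff)

lemma D_cong: "u \<in> S \<Longrightarrow> (\<And>s. s \<in> S \<Longrightarrow> Z s = W s) \<Longrightarrow> D x Z u = D x W u"
  unfolding nabla_def using dd_cong[OF open_S, of u Z W x] by simp

lemma D_add:
  assumes "u \<in> S" "Z differentiable (at u)" "W differentiable (at u)"
  shows "D x (\<lambda>s. Z s + W s) u = D x Z u + D x W u"
  unfolding nabla_def using assms by (simp add: dd_add bilinear_simps[OF bilinear_christoffel])

lemma D_diff:
  assumes "u \<in> S" "Z differentiable (at u)" "W differentiable (at u)"
  shows "D x (\<lambda>s. Z s - W s) u = D x Z u - D x W u"
  unfolding nabla_def using assms by (simp add: dd_diff bilinear_simps[OF bilinear_christoffel])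

lemma D_scaleR:
  assumes "u \<in> S" "a differentiable (at u)" "Z differentiable (at u)"
  shows "D x (\<lambda>s. a s *\<^sub>R Z s) u = a u *\<^sub>R D x Z u + dd a u x *\<^sub>R Z u"
  unfolding nabla_def using assms
  by (simp add: dd_scaleR bilinear_simps[OF bilinear_christoffel] scaleR_add_right)

lemma D_metric:
  assumes "u \<in> S" "Z differentiable (at u)" "W differentiable (at u)"
  shows "dd (\<lambda>s. h s (Z s) (W s)) u x = h u (D x Z u) (W u) + h u (Z u) (D x W u)"
  unfolding nabla_def smooth_bil_dd(1)[OF open_S assms(1) smooth_h assms(2,3)] metric_compat[OF assms(1)]
  by (simp add: bilinear_simps[OF bil[OF assms(1)]])

text \<open>The first two terms are the covariant derivative of \<open>L\<close> at the value
  \<open>Z u\<close>. Knowing it on constant fields thus gives the product rule for all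
  fields.\<close>

lemma D_lin:
  assumes "u \<in> S" "smooth_lin S L" "Z differentiable (at u)"
  shows "D x (\<lambda>s. L s (Z s)) u = D x (\<lambda>s. L s (Z u)) u - L u (christoffel h u x (Z u)) + L u (D x Z u)"
proof -
  have "linear (L u)" using assms unfolding smooth_lin_def by blast
  then show ?thesis
    unfolding nabla_def smooth_lin_dd(1)[OF open_S assms] by (simp add: linear_add)
qed

lemma curv_eq:
  "u \<in> S \<Longrightarrow> curv h u x y z = D x (\<lambda>s. christoffel h s y z) u - D y (\<lambda>s. christoffel h s x z) u"
  unfolding curv_def curvature_def nabla_const
  by (simp add: nabla_def lie_bracket_def bilinear_simps[OF bilinear_christoffel])

lemma differentiable_christoffel: "u \<in> S \<Longrightarrow> (\<lambda>s. christoffel h s x y) differentiable (at u)"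
  using smooth_christoffel smooth_on_differentiable unfolding smooth_bil_def by blast

text \<open>Makes the curvature, defined through constant extensions, available for a field such as
  \<open>\<phi> s z\<close>. Second derivatives of \<open>Z\<close> commute, terms with one
  derivative of \<open>Z\<close> are symmetric in \<open>x\<close> and \<open>y\<close>, and the
  rest sees only \<open>Z u\<close>.\<close>

lemma D_commutator:
  assumes "u \<in> S" "smooth_on S Z"
  shows "D x (D y Z) u - D y (D x Z) u = curv h u x y (Z u)"
proof -
  have Z: "Z differentiable (at u)" "\<And>v. (\<lambda>s. dd Z s v) differentiable (at u)"
    using assms smooth_on_differentiable smooth_on_dd by blast+
  have l: "smooth_lin S (\<lambda>s. christoffel h s y)" for y
    by (rule smooth_bil_lin(1)[OF smooth_christoffel])
  have "D x (D y Z) u = D x (\<lambda>s. dd Z s y) u + D x (\<lambda>s. christoffel h s y (Z s)) u" for x y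
    unfolding nabla_def[of h "\<lambda>_. y"]
    by (intro D_add assms Z smooth_lin_dd(2)[OF open_S assms(1) l])
  moreover have "dd (\<lambda>s. dd Z s y) u x = dd (\<lambda>s. dd Z s x) u y"
    by (rule second_derivative_symmetric[OF open_S assms(2,1)])
  ultimately show ?thesis
    unfolding curv_eq[OF assms(1)] D_lin[OF assms(1) l Z(1)]
    by (simp add: nabla_def bilinear_simps[OF bilinear_christoffel[OF assms(1)]])
qed

lemma linear_curv:
  assumes "u \<in> S"
  shows "linear (\<lambda>x. curv h u x y z)" "linear (\<lambda>y. curv h u x y z)" "linear (\<lambda>z. curv h u x y z)"
proof -
  note d = linear_dd[OF differentiable_christoffel[OF assms]]
    linear_dd_param[OF open_S assms smooth_bil_lin(1)[OF smooth_christoffel]]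
    linear_dd_param[OF open_S assms smooth_bil_lin(2)[OF smooth_christoffel]]
  show "linear (\<lambda>x. curv h u x y z)" "linear (\<lambda>y. curv h u x y z)" "linear (\<lambda>z. curv h u x y z)"
    unfolding curv_eq[OF assms] nabla_def
    by (rule linearI; simp add: bilinear_simps[OF bilinear_christoffel[OF assms]]
        linear_add[OF d(1)] linear_add[OF d(2)] linear_add[OF d(3)]
        linear_cmul[OF d(1)] linear_cmul[OF d(2)] linear_cmul[OF d(3)] algebra_simps)+
qed

lemma curv_skew: "u \<in> S \<Longrightarrow> curv h u x y z = - curv h u y x z"
  by (simp add: curv_eq)

text \<open>Absence of torsion: \<open>christoffel\<close> is symmetric, so every derivative term in
  the cyclic sum meets its negative.\<close>

lemma curv_bianchi: "u \<in> S \<Longrightarrow> curv h u x y z + curv h u y z x + curv h u z x y = 0"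
proof -
  assume u: "u \<in> S"
  have "D x (\<lambda>s. christoffel h s y z) u = D x (\<lambda>s. christoffel h s z y) u" for x y z
    by (rule D_cong[OF u christoffel_sym])
  from this[of x y z] this[of y z x] this[of z x y] show ?thesis by (simp add: curv_eq[OF u])
qed

text \<open>Second derivatives of \<open>h s z w\<close> commute. Expanded by metric compatibility,
  the products of two Christoffel terms are together symmetric in \<open>x\<close> and
  \<open>y\<close> and drop out of the difference.\<close>

lemma curv_metric_skew:
  assumes "u \<in> S"
  shows "h u (curv h u x y z) w = - h u (curv h u x y w) z"
proof -
  have eq: "dd (\<lambda>s. dd (\<lambda>s. h s z w) s y) u x
      = h u (D x (\<lambda>s. christoffel h s y z) u) w + h u (christoffel h u y z) (christoffel h u x w)
        + h u (christoffel h u x z) (christoffel h u y w) + h u z (D x (\<lambda>s. christoffel h s y w) u)" for x y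
  proof -
    have "dd (\<lambda>s. dd (\<lambda>s. h s z w) s y) u x
        = dd (\<lambda>s. h s (christoffel h s y z) w + h s z (christoffel h s y w)) u x"
      by (rule dd_cong[OF open_S assms metric_compat])
    also have "\<dots> = dd (\<lambda>s. h s (christoffel h s y z) w) u x + dd (\<lambda>s. h s z (christoffel h s y w)) u x"
      by (intro dd_add smooth_bil_dd(2)[OF open_S assms smooth_h] differentiable_christoffel[OF assms]) simp_all
    finally show ?thesis
      using D_metric[OF assms differentiable_christoffel[OF assms, of y z], of "\<lambda>_. w" x]
        D_metric[OF assms _ differentiable_christoffel[OF assms, of y w], of "\<lambda>_. z" x]
      by (simp add: nabla_const)
  qed
  have "smooth_on S (\<lambda>s. h s z w)" using smooth_h unfolding smooth_bil_def by blast
  from second_derivative_symmetric[OF open_S this assms, of x y]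
  have "h u (curv h u x y z) w + h u z (curv h u x y w) = 0"
    unfolding eq curv_eq[OF assms] by (simp add: bilinear_simps[OF bil[OF assms]])
  then show ?thesis using sym[OF assms] by simp
qed

end

section \<open>Curvature tensors of Kaehler type\<close>

text \<open>\<open>phi_phi\<close> constrains \<open>Q\<close> and not \<open>\<phi>\<close> itself:
  in a contact space \<phi> squares to minus the identity only up to multiples of \<xi>, and it is
  \<open>Q\<close> that annihilates \<xi>.\<close>

locale kaehler_like =
  fixes Q :: "'v::real_vector \<Rightarrow> 'v \<Rightarrow> 'v \<Rightarrow> 'v \<Rightarrow> real" and \<phi> :: "'v \<Rightarrow> 'v"
  assumes lin1: "linear (\<lambda>x. Q x y z w)"
    and lin3: "linear (\<lambda>z. Q x y z w)"
    and skew: "Q x y z w = - Q y x z w"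
    and skew': "Q x y z w = - Q x y w z"
    and bianchi: "Q x y z w + Q y z x w + Q z x y w = 0"
    and lin_phi: "linear \<phi>"
    and phi_inv: "Q x y (\<phi> z) (\<phi> w) = Q x y z w"
    and phi_phi: "Q x y (\<phi> (\<phi> z)) w = - Q x y z w"
    and hol: "Q x (\<phi> x) x (\<phi> x) = 0"
begin

text \<open>The octahedron argument: the Bianchi identities for the four cyclic shifts of the
  arguments are combined after the skew symmetries have matched their terms.\<close>

lemma pair_sym: "Q x y z w = Q z w x y"
proof -
  have "Q y z w x = - Q y z x w" "Q z w y x = - Q z w x y" "Q w y z x = - Q y w z x"
    "Q w x z y = Q x w y z" "Q x z w y = Q z x y w"
    "Q w x y z = - Q x w y z" "Q x y w z = - Q x y z w" "Q y w x z = - Q y w z x"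
    using skew skew' by (metis minus_minus)+
  then show ?thesis
    using bianchi[of x y z w] bianchi[of y z w x] bianchi[of z w x y] bianchi[of w x y z] by linarith
qed

lemma lin2: "linear (\<lambda>y. Q x y z w)"
proof -
  have "(\<lambda>y. Q x y z w) = (\<lambda>y. - Q y x z w)" using skew by blast
  then show ?thesis using linear_compose_neg[OF lin1] by simp
qed

lemma lin4: "linear (\<lambda>w. Q x y z w)"
proof -
  have "(\<lambda>w. Q x y z w) = (\<lambda>w. - Q x y w z)" using skew' by blast
  then show ?thesis using linear_compose_neg[OF lin3] by simp
qed

lemmas multilinear =
  linear_add[OF lin1] linear_add[OF lin2] linear_add[OF lin3] linear_add[OF lin4]
  linear_diff[OF lin1] linear_diff[OF lin2] linear_diff[OF lin3] linear_diff[OF lin4]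

lemma phi_inv': "Q (\<phi> x) (\<phi> y) z w = Q x y z w"
  using phi_inv pair_sym by metis

lemma phi_phi': "Q x (\<phi> (\<phi> y)) z w = - Q x y z w"
  using phi_phi pair_sym skew by metis

lemma phi_move: "Q x (\<phi> y) z w = - Q (\<phi> x) y z w"
  using phi_inv'[of x "\<phi> y" z w] phi_phi'[of "\<phi> x" y z w] by simp

text \<open>Since \<open>A x y z w = Q x (\<phi> y) z (\<phi> w)\<close> is symmetric in \<open>x, y\<close> and in \<open>z, w\<close>, polarising \<open>hol\<close>
  and the Bianchi identity give two relations between \<open>A x x y y\<close> and \<open>A x y x y\<close>. Eliminating \<open>A x x y y\<close>
  gives \<open>key\<close>, whose instances at \<open>y\<close> and at \<open>\<phi> y\<close> are linearly independent.\<close>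

lemma sectional_zero: "Q x y x y = 0"
proof -
  have key: "3 * Q x (\<phi> y) x (\<phi> y) + Q x y x y = 0" for x y
  proof -
    define A where "A x y z w = Q x (\<phi> y) z (\<phi> w)" for x y z w
    have sym12: "A x y z w = A y x z w" for x y z w
      unfolding A_def using phi_move[of x y z "\<phi> w"] skew[of "\<phi> x" y] by simp
    have sym34: "A x y z w = A x y w z" for x y z w
      unfolding A_def using pair_sym phi_move skew by metis
    have sym: "A x y z w = A z w x y" for x y z w
      unfolding A_def by (rule pair_sym)
    \<comment> \<open>Summing over \<open>x + y\<close> and \<open>x - y\<close> removes the terms
      of odd degree in \<open>y\<close>.\<close>
    have "A (x + y) (x + y) (x + y) (x + y) + A (x - y) (x - y) (x - y) (x - y)
      = 2 * (A x x x x + A y y y y + A x x y y + A y y x x + A x y x y + A x y y x + A y x x y + A y x y x)"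
      unfolding A_def by (simp add: multilinear linear_add[OF lin_phi] linear_diff[OF lin_phi])
    then have "A x x y y + 2 * A x y x y = 0"
      using hol[of x] hol[of y] hol[of "x + y"] hol[of "x - y"] sym[of y y x x] sym12[of y x]
        sym34[of x y y x] unfolding A_def by simp
    moreover have "A x x y y = A x y x y + Q x y x y"
      using bianchi[of x "\<phi> x" y "\<phi> y"] phi_move[of x y x "\<phi> y"] phi_inv[of y x x y] skew[of y x x y]
      unfolding A_def by simp
    ultimately show ?thesis unfolding A_def by simp
  qed
  have "Q x (\<phi> (\<phi> y)) x (\<phi> (\<phi> y)) = Q x y x y"
    unfolding phi_phi' pair_sym[of x y x "\<phi> (\<phi> y)"] by simp
  then show ?thesis using key[of x y] key[of x "\<phi> y"] by linarith
qed

text \<open>Polarisation in the first and third slots, which pair symmetry makes interchangeable. In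
  the application \<open>y\<close> is the tension field, which fills exactly the second and fourth
  slots.\<close>

lemma Q_zero: "Q x y z y = 0"
  using sectional_zero[of "x + z" y] sectional_zero[of x y] sectional_zero[of z y] pair_sym[of x y z y]
  by (simp add: multilinear)

end

text \<open>The structure at one point, with \<eta> replaced by the pairing with
  \<open>\<xi>\<close>. This separates the algebra of curvature tensors from the differential
  identities that feed it.\<close>

locale contact_space =
  fixes h :: "'v::real_vector \<Rightarrow> 'v \<Rightarrow> real" and \<xi> :: 'v and \<phi> :: "'v \<Rightarrow> 'v"
  assumes bil: "bilinear h"
    and sym: "h v w = h w v"
    and pos: "v \<noteq> 0 \<Longrightarrow> 0 < h v v"
    and lin_phi: "linear \<phi>"
    and xi_xi: "h \<xi> \<xi> = 1"
    and phi_phi: "\<phi> (\<phi> v) = - v + h v \<xi> *\<^sub>R \<xi>"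
    and phi_h: "h (\<phi> v) (\<phi> w) = h v w - h v \<xi> * h w \<xi>"
begin

lemmas h_simps = bilinear_simps[OF bil]
lemmas phi_simps = linear_add[OF lin_phi] linear_diff[OF lin_phi] linear_cmul[OF lin_phi]
  linear_neg[OF lin_phi] linear_0[OF lin_phi]

lemma phi_xi: "\<phi> \<xi> = 0"
  using pos[of "\<phi> \<xi>"] phi_h[of \<xi> \<xi>] xi_xi by fastforce

text \<open>Compute the cube of \<phi> in two ways: \<phi> applied to
  \<open>\<phi> (\<phi> v)\<close> gives \<open>- \<phi> v\<close> since \<phi> \<xi> = 0, while the
  square applied to \<open>\<phi> v\<close> has the extra term \<open>h (\<phi> v) \<xi>\<close>
  times \<xi>.\<close>

lemma xi_phi: "h (\<phi> v) \<xi> = 0" "h \<xi> (\<phi> v) = 0"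
proof -
  have "\<phi> (\<phi> (\<phi> v)) = - \<phi> v" unfolding phi_phi[of v] by (simp add: phi_simps phi_xi)
  then have "h (\<phi> v) \<xi> *\<^sub>R \<xi> = 0" unfolding phi_phi[of "\<phi> v"] by simp
  moreover have "\<xi> \<noteq> 0" using xi_xi h_simps(9)[of \<xi>] by auto
  ultimately show "h (\<phi> v) \<xi> = 0" by simp
  then show "h \<xi> (\<phi> v) = 0" by (simp add: sym)
qed

lemma phi_skew: "h (\<phi> v) w = - h v (\<phi> w)"
  using phi_h[of "\<phi> v" w] unfolding phi_phi by (simp add: h_simps xi_phi)

definition R1 :: "'v \<Rightarrow> 'v \<Rightarrow> 'v \<Rightarrow> 'v" where
  "R1 x y z = h y z *\<^sub>R x - h x z *\<^sub>R y"

definition R2 :: "'v \<Rightarrow> 'v \<Rightarrow> 'v \<Rightarrow> 'v" where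
  "R2 x y z = (h x \<xi> * h z \<xi>) *\<^sub>R y - (h y \<xi> * h z \<xi>) *\<^sub>R x
     + (h x z * h y \<xi>) *\<^sub>R \<xi> - (h y z * h x \<xi>) *\<^sub>R \<xi>"

definition R3 :: "'v \<Rightarrow> 'v \<Rightarrow> 'v \<Rightarrow> 'v" where
  "R3 x y z = h z (\<phi> y) *\<^sub>R \<phi> x - h z (\<phi> x) *\<^sub>R \<phi> y + (2 * h x (\<phi> y)) *\<^sub>R \<phi> z"

definition model_curv :: "real \<Rightarrow> real \<Rightarrow> 'v \<Rightarrow> 'v \<Rightarrow> 'v \<Rightarrow> 'v" where
  "model_curv \<epsilon> k x y z = \<epsilon> *\<^sub>R R1 x y z + k *\<^sub>R (R1 x y z + R2 x y z + R3 x y z)"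

text \<open>The sum vanishes as soon as one argument is \<xi>; on the complement of \<xi> it is
  \<open>R1 + R3\<close>, which has the shape of the curvature of a complex space form of
  holomorphic sectional curvature 4.\<close>

lemma R123_commute_phi: "R1 x y (\<phi> z) + R2 x y (\<phi> z) + R3 x y (\<phi> z) = \<phi> (R1 x y z + R2 x y z + R3 x y z)"
proof -
  have "h z (\<phi> x) = - h x (\<phi> z)" for x using phi_skew[of x z] sym[of z] by simp
  from this[of x] this[of y] show ?thesis
    unfolding R1_def R2_def R3_def
    by (simp add: phi_simps phi_phi phi_xi xi_phi phi_h sym[of z x] sym[of z y] algebra_simps)
qed

lemma model_curv_commute_phi:
  "model_curv \<epsilon> k x y (\<phi> z) - \<phi> (model_curv \<epsilon> k x y z) = \<epsilon> *\<^sub>R (R1 x y (\<phi> z) - \<phi> (R1 x y z))"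
  unfolding model_curv_def R123_commute_phi by (simp add: phi_simps scaleR_diff_right)

lemma model_curv_lin: "linear (\<lambda>x. model_curv \<epsilon> k x y z)" "linear (\<lambda>z. model_curv \<epsilon> k x y z)"
  unfolding model_curv_def R1_def R2_def R3_def
  by (rule linearI; simp add: h_simps phi_simps algebra_simps)+

lemma h_phi: "h x (\<phi> y) = - h y (\<phi> x)"
  using phi_skew[of y x] sym[of x] by simp

lemma model_curv_h:
  "h (model_curv \<epsilon> k x y z) w = \<epsilon> * (h y z * h x w - h x z * h y w)
    + k * (h y z * h x w - h x z * h y w
      + h x \<xi> * h z \<xi> * h y w - h y \<xi> * h z \<xi> * h x w + h x z * h y \<xi> * h w \<xi> - h y z * h x \<xi> * h w \<xi>
      + h z (\<phi> y) * h w (\<phi> x) - h z (\<phi> x) * h w (\<phi> y) + 2 * h x (\<phi> y) * h w (\<phi> z))"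
  unfolding model_curv_def R1_def R2_def R3_def
  by (simp add: h_simps sym[of \<xi> w] sym[of "\<phi> _" w] algebra_simps)

text \<open>In \<open>sect\<close>, \<open>R1\<close> contributes 1 and \<open>R1 + R2 + R3\<close>
  contributes 4 to the \<phi>-sectional curvature. By \<open>comm\<close>, \<open>R\<close> and the
  model fail to commute with \<phi> by the same amount, so their difference \<open>T\<close>
  commutes with it.\<close>

lemma curvature_determined:
  assumes lin: "\<And>y z. linear (\<lambda>x. R x y z)" "\<And>x y. linear (\<lambda>z. R x y z)"
    and skew: "\<And>x y z. R x y z = - R y x z"
    and bianchi: "\<And>x y z. R x y z + R y z x + R z x y = 0"
    and skew': "\<And>x y z w. h (R x y z) w = - h (R x y w) z"
    and comm: "\<And>x y z. R x y (\<phi> z) - \<phi> (R x y z) = \<epsilon> *\<^sub>R (R1 x y (\<phi> z) - \<phi> (R1 x y z))"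
    and sect: "\<And>x. h x \<xi> = 0 \<Longrightarrow> h (R x (\<phi> x) (\<phi> x)) x = (\<epsilon> + 4 * k) * (h x x)\<^sup>2"
  shows "h (R x y z) y = h (model_curv \<epsilon> k x y z) y"
proof -
  define T where "T x y z = R x y z - model_curv \<epsilon> k x y z" for x y z
  define Q where "Q x y z w = h (T x y z) w" for x y z w
  note hlin = bilinearD(2)[OF bil]
  have Tlin: "linear (\<lambda>x. T x y z)" "linear (\<lambda>z. T x y z)" for x y z
    unfolding T_def by (intro linear_compose_sub lin model_curv_lin)+
  have Qlin1: "linear (\<lambda>x. Q x y z w)" for y z w
    unfolding Q_def using linear_compose[OF Tlin(1) hlin] by (simp add: o_def)
  have Qlin3: "linear (\<lambda>z. Q x y z w)" for x y w
    unfolding Q_def using linear_compose[OF Tlin(2) hlin] by (simp add: o_def)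
  have Qskew: "Q x y z w = - Q y x z w" for x y z w
    unfolding Q_def T_def h_simps model_curv_h
    using skew[of x y z] h_phi[of x y] by (simp add: h_simps algebra_simps)
  have Qskew': "Q x y z w = - Q x y w z" for x y z w
    unfolding Q_def T_def h_simps model_curv_h
    using skew'[of x y z w] h_phi[of w z] by (simp add: algebra_simps)
  have Tcomm: "T x y (\<phi> z) = \<phi> (T x y z)" for x y z
    using comm[of x y z, unfolded diff_eq_eq] model_curv_commute_phi[of \<epsilon> k x y z, unfolded diff_eq_eq]
    by (simp add: T_def phi_simps)
  have Qb: "Q x y z w + Q y z x w + Q z x y w = 0" for x y z w
  proof -
    have "h (R x y z) w + h (R y z x) w + h (R z x y) w = 0"
      using bianchi[of x y z] by (metis h_simps(1) h_simps(9))
    then show ?thesis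
      unfolding Q_def T_def h_simps model_curv_h
      using h_phi[of y x] h_phi[of z x] h_phi[of z y] sym[of y x] sym[of z x] sym[of z y]
      by (simp add: algebra_simps)
  qed
  \<comment> \<open>Commuting with \<phi> puts \<open>T x y \<xi>\<close> into the kernel of \<phi>,
    so it is a multiple of \<xi>; skewness in the last two slots kills that multiple.\<close>
  have Qxi: "Q x y \<xi> w = 0" for x y w
  proof -
    have "Q x y \<xi> \<xi> = 0" using Qskew'[of x y \<xi> \<xi>] by simp
    moreover have "\<phi> (T x y \<xi>) = 0"
      using Tcomm[of x y \<xi>] linear_0[OF Tlin(2)] by (simp add: phi_xi)
    ultimately show ?thesis
      using phi_h[of "T x y \<xi>" w] by (simp add: Q_def h_simps)
  qed
  have Qxi': "Q x y w \<xi> = 0" for x y w using Qxi Qskew' by (metis neg_0_equal_iff_equal)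
  have Qinv: "Q x y (\<phi> z) (\<phi> w) = Q x y z w" for x y z w
    using Qxi'[of x y z] by (simp add: Q_def Tcomm phi_h)
  have Qphi2: "Q x y (\<phi> (\<phi> z)) w = - Q x y z w" for x y z w
    using Qxi[of x y w] linear_diff[OF Qlin3] linear_cmul[OF Qlin3] by (simp add: phi_phi)
  \<comment> \<open>Pair symmetry by hand: \<open>pair_sym\<close> becomes available only with the
    interpretation, which needs \<open>hol\<close> and therefore this fact.\<close>
  have Qxi'': "Q \<xi> y z w = 0" "Q y \<xi> z w = 0" for y z w
  proof -
    show "Q \<xi> y z w = 0" using Qb[of \<xi> y z w] Qb[of y z w \<xi>] Qb[of z w \<xi> y] Qb[of w \<xi> y z]
        Qxi Qxi' Qskew Qskew' by (smt (verit))
    then show "Q y \<xi> z w = 0" using Qskew by (metis neg_0_equal_iff_equal)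
  qed
  have hol0: "Q x (\<phi> x) x (\<phi> x) = 0" if "h x \<xi> = 0" for x
  proof -
    have x: "\<phi> (\<phi> x) = - x" "h x (\<phi> x) = 0" using h_phi[of x x] that by (simp_all add: phi_phi)
    have "h (model_curv \<epsilon> k x (\<phi> x) (\<phi> x)) x = (\<epsilon> + 4 * k) * (h x x)\<^sup>2"
      unfolding model_curv_h using that
      by (simp add: x xi_phi phi_h h_simps sym[of "\<phi> x" x] power2_eq_square algebra_simps)
    then have "Q x (\<phi> x) (\<phi> x) x = 0"
      using sect[OF that] unfolding Q_def T_def h_simps by simp
    then show ?thesis using Qskew' by (metis neg_0_equal_iff_equal)
  qed
  \<comment> \<open>\<open>sect\<close> covers only vectors orthogonal to \<xi>; \<phi> and
    \<open>Q\<close> ignore the remaining component.\<close>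
  have hol: "Q x (\<phi> x) x (\<phi> x) = 0" for x
  proof -
    define x' where "x' = x - h x \<xi> *\<^sub>R \<xi>"
    have x: "x = x' + h x \<xi> *\<^sub>R \<xi>" and p: "\<phi> x = \<phi> x'" by (simp_all add: x'_def phi_simps phi_xi)
    have "Q x (\<phi> x') x (\<phi> x') = Q x' (\<phi> x') x' (\<phi> x')"
      by (subst (1 2) x) (simp add: linear_add[OF Qlin1] linear_cmul[OF Qlin1]
          linear_add[OF Qlin3] linear_cmul[OF Qlin3] Qxi Qxi'')
    moreover have "h x' \<xi> = 0" by (simp add: x'_def h_simps xi_xi)
    ultimately show ?thesis using hol0 p by simp
  qed
  interpret kaehler_like Q \<phi>
    by (intro kaehler_like.intro Qlin1 Qlin3 Qskew Qskew' Qb lin_phi Qinv Qphi2 hol)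
  show ?thesis using Q_zero[of x y z] unfolding Q_def T_def h_simps by simp
qed

end

section \<open>The curvature of a contact space form\<close>

context metric_chart
begin

lemma D_minus: "u \<in> S \<Longrightarrow> Z differentiable (at u) \<Longrightarrow> D x (\<lambda>s. - Z s) u = - D x Z u"
  using D_diff[of u "\<lambda>_. 0" Z x] by (simp add: nabla_const bilinear_simps[OF bilinear_christoffel])

end

text \<open>The curvature of the space form is \<open>eps * R1 + f2 * (R1 + R2 + R3)\<close>, where the second summand
  commutes with \<open>\<phi>\<close>.\<close>

fun eps :: "structure_kind \<Rightarrow> real" where
  "eps Sasakian = 1"
| "eps Kenmotsu = - 1"
| "eps Cosymplectic = 0"

lemma f1_eq: "f1 K c = eps K + f2 K c"
  by (cases K) (simp_all add: field_simps)

lemma phi_sectional_eq: "eps K + 4 * f2 K c = c"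
  by (cases K) (simp_all add: field_simps)

locale contact_chart = metric_chart S h
  for S :: "(real ^ 'm::finite) set" and h :: "'m lmetric" +
  fixes K :: structure_kind and \<xi> :: "'m lvec" and \<phi> :: "'m lendo" and c :: real
  assumes smooth_xi: "smooth_on S \<xi>"
    and smooth_phi: "smooth_lin S \<phi>"
    and contact: "u \<in> S \<Longrightarrow> contact_space (h u) (\<xi> u) (\<phi> u)"
    and nabla_phi: "u \<in> S \<Longrightarrow> nabla_endo h \<phi> (\<lambda>_. x) (\<lambda>_. y) u
      = nabla_phi_rhs K h \<xi> (\<lambda>s v. h s v (\<xi> s)) \<phi> u x y"
    and sect: "u \<in> S \<Longrightarrow> x \<noteq> 0 \<Longrightarrow> h u x (\<xi> u) = 0 \<Longrightarrow> sectional h u x (\<phi> u x) = c"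
begin

definition T :: "real ^ 'm \<Rightarrow> real ^ 'm \<Rightarrow> real ^ 'm \<Rightarrow> real ^ 'm" where
  "T u x y = nabla_phi_rhs K h \<xi> (\<lambda>s v. h s v (\<xi> s)) \<phi> u x y"

lemma D_phi:
  assumes "u \<in> S" "Z differentiable (at u)"
  shows "D x (\<lambda>s. \<phi> s (Z s)) u = \<phi> u (D x Z u) + T u x (Z u)"
  using nabla_phi[OF assms(1), of x "Z u"] D_lin[OF assms(1) smooth_phi assms(2), of x]
  by (simp add: T_def nabla_endo_def nabla_const)

text \<open>Differentiating \<phi> \<xi> = 0 determines \<phi> of the derivative. By |\<xi>| = 1 the
  derivative is orthogonal to \<xi>, where applying \<phi> once more inverts it up to sign.\<close>

lemma D_xi:
  assumes "u \<in> S" shows "D x \<xi> u = \<phi> u (T u x (\<xi> u))"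
proof -
  interpret C: contact_space "h u" "\<xi> u" "\<phi> u" by (rule contact[OF assms])
  have xi: "\<xi> differentiable (at u)" by (rule smooth_on_differentiable[OF smooth_xi assms])
  have "D x (\<lambda>s. \<phi> s (\<xi> s)) u = D x (\<lambda>_. 0) u"
    by (rule D_cong[OF assms contact_space.phi_xi[OF contact]])
  then have 1: "\<phi> u (D x \<xi> u) + T u x (\<xi> u) = 0"
    unfolding D_phi[OF assms xi] by (simp add: nabla_const bilinear_simps[OF bilinear_christoffel[OF assms]])
  have "dd (\<lambda>s. h s (\<xi> s) (\<xi> s)) u x = dd (\<lambda>_. 1) u x"
    by (rule dd_cong[OF open_S assms contact_space.xi_xi[OF contact]])
  then have 2: "h u (D x \<xi> u) (\<xi> u) = 0"
    unfolding D_metric[OF assms xi xi] by (simp add: C.sym[of "\<xi> u"])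
  show ?thesis
    using arg_cong[OF 1, of "\<phi> u"] 2 by (simp add: C.phi_simps C.phi_phi)
qed

lemma differentiable_h: "u \<in> S \<Longrightarrow> Z differentiable (at u) \<Longrightarrow> W differentiable (at u)
    \<Longrightarrow> (\<lambda>s. h s (Z s) (W s)) differentiable (at u)"
  using smooth_bil_dd(2)[OF open_S _ smooth_h] by blast

text \<open>The left-hand side is the alternation of the second covariant derivative of \<phi>, that
  is, of the derivative of the prescribed \<open>T\<close>. Differentiating \<open>T\<close>
  involves only \<phi>, \<xi> and the metric, whose covariant derivatives are known.\<close>

lemma curv_phi_commutator:
  assumes "u \<in> S"
  shows "curv h u x y (\<phi> u z) - \<phi> u (curv h u x y z)
    = eps K *\<^sub>R (contact_space.R1 (h u) x y (\<phi> u z) - \<phi> u (contact_space.R1 (h u) x y z))"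
proof -
  interpret C: contact_space "h u" "\<xi> u" "\<phi> u" by (rule contact[OF assms])
  note Dmetric_const = D_metric[OF assms differentiable_const, simplified nabla_const]
  have xi: "\<xi> differentiable (at u)" by (rule smooth_on_differentiable[OF smooth_xi assms])
  have phi: "(\<lambda>s. \<phi> s y) differentiable (at u)" for y
    using smooth_on_differentiable[OF _ assms] smooth_phi unfolding smooth_lin_def by blast
  have Dphi: "D x (\<lambda>s. \<phi> s y) u = \<phi> u (christoffel h u x y) + T u x y" for x y
    using D_phi[OF assms, of "\<lambda>_. y" x] by (simp add: nabla_const)
  have T_diff: "(\<lambda>s. T s y z) differentiable (at u)" for y z
    unfolding T_def
    by (cases K) (auto intro!: differentiable_diff differentiable_minus differentiable_scaleR
        differentiable_h assms xi phi)
  have main: "D x (D y (\<lambda>s. \<phi> s z)) u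
      = \<phi> u (D x (\<lambda>s. christoffel h s y z) u) + T u x (christoffel h u y z) + D x (\<lambda>s. T s y z) u" for x y
  proof -
    have "D x (D y (\<lambda>s. \<phi> s z)) u = D x (\<lambda>s. \<phi> s (christoffel h s y z) + T s y z) u"
      using D_phi[of _ "\<lambda>_. z" y] by (intro D_cong[OF assms]) (simp add: nabla_const)
    also have "\<dots> = D x (\<lambda>s. \<phi> s (christoffel h s y z)) u + D x (\<lambda>s. T s y z) u"
      by (intro D_add assms T_diff smooth_lin_dd(2)[OF open_S assms smooth_phi] differentiable_christoffel)
    finally show ?thesis
      using D_phi[OF assms differentiable_christoffel[OF assms, of y z], of x] by simp
  qed
  have "smooth_on S (\<lambda>s. \<phi> s z)" using smooth_phi unfolding smooth_lin_def by blast
  \<comment> \<open>The result alternates the covariant derivative of \<open>T\<close> in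
    \<open>x\<close> and \<open>y\<close>; its term \<open>T u (christoffel h u x y) z\<close> is
    symmetric and has cancelled.\<close>
  from D_commutator[OF assms this, of x y]
  have "curv h u x y (\<phi> u z) - \<phi> u (curv h u x y z)
      = T u x (christoffel h u y z) + D x (\<lambda>s. T s y z) u
        - (T u y (christoffel h u x z) + D y (\<lambda>s. T s x z) u)"
    unfolding main curv_eq[OF assms, of x y z] by (simp add: C.phi_simps algebra_simps)
  also have "\<dots> = eps K *\<^sub>R (C.R1 x y (\<phi> u z) - \<phi> u (C.R1 x y z))"
  proof (cases K)
    case K: Sasakian
    have T: "T s x y = h s x y *\<^sub>R \<xi> s - h s y (\<xi> s) *\<^sub>R x" for s x y
      unfolding T_def by (simp add: K)
    have Dxi: "D x \<xi> u = - \<phi> u x" for x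
      unfolding D_xi[OF assms] T by (simp add: C.phi_simps C.phi_xi C.xi_xi)
    have DT: "D x (\<lambda>s. T s y z) u
        = h u y z *\<^sub>R - \<phi> u x + (h u (christoffel h u x y) z + h u y (christoffel h u x z)) *\<^sub>R \<xi> u
          - (h u z (\<xi> u) *\<^sub>R christoffel h u x y
             + (h u (christoffel h u x z) (\<xi> u) - h u z (\<phi> u x)) *\<^sub>R y)" for x y
      unfolding T
      by (simp add: D_diff[OF assms] D_scaleR[OF assms] differentiable_h[OF assms] differentiable_scaleR xi
          Dmetric_const metric_compat[OF assms] nabla_const Dxi C.h_simps)
    show ?thesis
      unfolding DT unfolding T using christoffel_sym[OF assms, of y x] C.h_phi[of z x] C.h_phi[of z y]
      by (simp add: K C.R1_def C.phi_simps C.sym[of _ z] C.phi_skew algebra_simps)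
  next
    case K: Kenmotsu
    have T: "T s x y = - (h s y (\<xi> s) *\<^sub>R \<phi> s x) - h s x (\<phi> s y) *\<^sub>R \<xi> s" for s x y
      unfolding T_def by (simp add: K)
    have Dxi: "D x \<xi> u = x - h u x (\<xi> u) *\<^sub>R \<xi> u" for x
      unfolding D_xi[OF assms] T by (simp add: C.phi_simps C.phi_xi C.xi_xi C.phi_phi C.h_simps)
    have DT: "D x (\<lambda>s. T s y z) u
        = - (h u z (\<xi> u) *\<^sub>R (\<phi> u (christoffel h u x y) + T u x y)
            + (h u (christoffel h u x z) (\<xi> u) + h u z (x - h u x (\<xi> u) *\<^sub>R \<xi> u)) *\<^sub>R \<phi> u y)
          - (h u y (\<phi> u z) *\<^sub>R (x - h u x (\<xi> u) *\<^sub>R \<xi> u)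
            + (h u (christoffel h u x y) (\<phi> u z) + h u y (\<phi> u (christoffel h u x z) + T u x z)) *\<^sub>R \<xi> u)" for x y
      unfolding T
      by (simp add: D_diff[OF assms] D_minus[OF assms] D_scaleR[OF assms] differentiable_h[OF assms]
          differentiable_scaleR differentiable_minus xi phi Dmetric_const Dphi Dxi T)
    show ?thesis
      unfolding DT unfolding T using christoffel_sym[OF assms, of y x] C.h_phi[of y x]
      by (simp add: K C.R1_def C.phi_simps C.h_simps C.sym[of _ z] C.phi_skew algebra_simps)
  next
    case K: Cosymplectic
    have "T s x y = 0" for s x y unfolding T_def by (simp add: K)
    then show ?thesis
      by (simp add: K nabla_const bilinear_simps[OF bilinear_christoffel[OF assms]])
  qed
  finally show ?thesis .
qed

text \<open>Orthogonality of \<open>y\<close> to \<xi> is what the tension field satisfies. Of the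
  three terms of \<open>R3\<close> one dies because \<open>h u y (\<phi> u y) = 0\<close>; the
  others weigh 1 and 2, hence the 3.\<close>

lemma curv_contact:
  assumes "u \<in> S" "h u y (\<xi> u) = 0"
  shows "h u (curv h u x y z) y = f1 K c * (h u y z * h u x y - h u x z * h u y y)
    + f2 K c * (h u x (\<xi> u) * h u z (\<xi> u) * h u y y) - 3 * f2 K c * (h u x (\<phi> u y) * h u z (\<phi> u y))"
proof -
  interpret C: contact_space "h u" "\<xi> u" "\<phi> u" by (rule contact[OF assms(1)])
  have s: "h u (curv h u x (\<phi> u x) (\<phi> u x)) x = (eps K + 4 * f2 K c) * (h u x x)\<^sup>2" if "h u x (\<xi> u) = 0" for x
  proof (cases "x = 0")
    case True
    then show ?thesis by (simp add: C.h_simps)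
  next
    case False
    have "h u x (\<phi> u x) = 0" using C.h_phi[of x x] by simp
    moreover have "h u x x \<noteq> 0" using C.pos[OF False] by simp
    ultimately show ?thesis
      using sect[OF assms(1) False that] that
      unfolding phi_sectional_eq sectional_def by (simp add: C.phi_h field_simps power2_eq_square)
  qed
  have "h u (curv h u x y z) y = h u (C.model_curv (eps K) (f2 K c) x y z) y"
    by (rule C.curvature_determined[OF linear_curv(1,3)[OF assms(1)] curv_skew[OF assms(1)]
          curv_bianchi[OF assms(1)] curv_metric_skew[OF assms(1)] curv_phi_commutator[OF assms(1)] s])
  moreover have "h u y (\<phi> u y) = 0" using C.h_phi[of y y] by simp
  ultimately show ?thesis
    unfolding C.model_curv_h f1_eq using assms(2) C.h_phi[of y x] C.h_phi[of y z]
    by (simp add: algebra_simps)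
qed

end

section \<open>Isometric immersions in charts\<close>

lemma mtrace_linear:
  assumes "linear L"
  shows "L (mtrace g u b) = mtrace g u (\<lambda>x y. L (b x y))"
  unfolding mtrace_def by (simp add: linear_sum[OF assms] linear_cmul[OF assms])

lemma mtrace_add: "mtrace g u (\<lambda>x y. b x y + b' x y) = mtrace g u b + mtrace g u b'"
  unfolding mtrace_def by (simp add: scaleR_add_right sum.distrib)

lemma mtrace_mult: "mtrace g u (\<lambda>x y. a * b x y) = a * mtrace g u b" for a :: real
  unfolding mtrace_def by (simp add: sum_distrib_left mult.left_commute)

context metric_chart
begin

lemma mtrace_metric: "u \<in> S \<Longrightarrow> mtrace h u (h u) = CARD('m)"
proof -
  assume u: "u \<in> S"
  have "mtrace h u (h u) = (\<Sum>i\<in>UNIV. (gram_inv h u ** gram u) $ i $ i)"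
    unfolding mtrace_def matrix_matrix_mult_def gram_def
    by (auto intro!: sum.cong simp: sym[OF u])
  also have "\<dots> = CARD('m)" unfolding gram_inv_mult[OF u] by (simp add: mat_def)
  finally show ?thesis .
qed

text \<open>This is how |\<xi>|^2 and |\<phi> \<tau>|^2 arise from the trace of the
  curvature.\<close>

lemma mtrace_rank_one: "u \<in> S \<Longrightarrow> mtrace h u (\<lambda>x y. h u x z * h u y z) = h u z z"
proof -
  assume u: "u \<in> S"
  have "gram_inv h u *v (gram u *v z) = z"
    by (simp add: matrix_vector_mul_assoc gram_inv_mult[OF u])
  then have "(\<Sum>j\<in>UNIV. gram_inv h u $ i $ j * h u (axis j 1) z) = z $ i" for i
    using gram_mult[OF u, of z] by (metis (no_types, lifting) matrix_vector_mult_def sum.cong vec_lambda_beta)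
  then have "mtrace h u (\<lambda>x y. h u x z * h u y z) = (\<Sum>i\<in>UNIV. h u (axis i 1) z * z $ i)"
    unfolding mtrace_def by (simp add: mult.left_commute sum_distrib_left[symmetric])
  also have "\<dots> = h u z z"
    using linear_axis_sum[OF bilinearD(2)[OF bil[OF u]], where v = z] by (simp add: mult.commute)
  finally show ?thesis .
qed

text \<open>Writing \<open>L\<close> as the pairing with a vector \<open>z\<close> turns the trace
  into \<open>h u z z\<close>. Semidefinite forms are sums of such squares, which replaces the
  diagonal sum over an orthonormal frame.\<close>

lemma mtrace_square_nonneg:
  fixes L :: "real ^ 'm \<Rightarrow> real"
  assumes "u \<in> S" "linear L"
  shows "0 \<le> mtrace h u (\<lambda>x y. L x * L y)"
proof -
  define z where "z = (\<chi> k. \<Sum>l\<in>UNIV. gram_inv h u $ k $ l * L (axis l 1))"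
  have "L x = h u x z" for x
    using gram_inv_raise[OF assms, of x] sym[OF assms(1)] unfolding z_def by simp
  then have "mtrace h u (\<lambda>x y. L x * L y) = h u z z" using mtrace_rank_one[OF assms(1)] by simp
  then show ?thesis
    using pos[OF assms(1), of z] bilinear_simps(9)[OF bil[OF assms(1)]] by (cases "z = 0") auto
qed

lemma mtrace_nonneg:
  fixes b :: "real ^ 'm \<Rightarrow> real ^ 'm \<Rightarrow> real"
  assumes "u \<in> S" "bilinear b" "\<And>x y. b x y = b y x" "\<And>x. 0 \<le> b x x"
  shows "0 \<le> mtrace h u b"
proof -
  \<comment> \<open>Complete one square at a time; \<open>I\<close> contains the coordinates that \<open>b\<close> still involves.\<close>
  have "finite I \<Longrightarrow> bilinear b \<Longrightarrow> (\<And>x y. b x y = b y x) \<Longrightarrow> (\<And>x. 0 \<le> b x x)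
      \<Longrightarrow> (\<And>i y. i \<notin> I \<Longrightarrow> b (axis i 1) y = 0) \<Longrightarrow> 0 \<le> mtrace h u b"
    for I and b :: "real ^ 'm \<Rightarrow> real ^ 'm \<Rightarrow> real"
  proof (induction I arbitrary: b rule: finite_induct)
    case empty
    then show ?case by (simp add: mtrace_def)
  next
    case (insert i I)
    note b = bilinear_simps[OF insert.prems(1)]
    let ?e = "axis i 1 :: real ^ 'm"
    let ?a = "b ?e ?e"
    show ?case
    proof (cases "?a = 0")
      case True
      have "b ?e y = 0" for y
      proof (rule ccontr)
        assume ne: "b ?e y \<noteq> 0"
        \<comment> \<open>Since \<open>?a = 0\<close>, the value of \<open>b\<close> at
          \<open>y + t e\<close> is affine in \<open>t\<close>; this \<open>t\<close> makes it -1.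
          Hence a null vector of a semidefinite form lies in its radical.\<close>
        define t where "t = - (b y y + 1) / (2 * b ?e y)"
        have "b (y + t *\<^sub>R ?e) (y + t *\<^sub>R ?e) = b y y + 2 * t * b ?e y"
          using True insert.prems(2)[of y ?e] by (simp add: b algebra_simps)
        also have "\<dots> = - 1" using ne by (simp add: t_def field_simps)
        finally show False using insert.prems(3)[of "y + t *\<^sub>R ?e"] by simp
      qed
      then show ?thesis
        using insert.prems by (intro insert.IH) (metis insert_iff)+
    next
      case False
      then have a: "0 < ?a" using insert.prems(3)[of ?e] by simp
      \<comment> \<open>The subtracted square absorbs row \<open>i\<close>. Semidefiniteness
        survives because \<open>b' x x\<close> is the value of \<open>b\<close> at the component of
        \<open>x\<close> that is \<open>b\<close>-orthogonal to \<open>?e\<close>.\<close>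
      define b' where "b' x y = b x y - b x ?e * b y ?e / ?a" for x y
      have "0 \<le> mtrace h u b'"
      proof (rule insert.IH)
        show "bilinear b'"
          unfolding bilinear_def b'_def by (intro conjI allI linearI) (simp_all add: b add_divide_distrib algebra_simps)
        show "b' x y = b' y x" for x y
          unfolding b'_def using insert.prems(2)[of x y] by simp
        show "0 \<le> b' x x" for x
        proof -
          have "b (x - (b x ?e / ?a) *\<^sub>R ?e) (x - (b x ?e / ?a) *\<^sub>R ?e) = b' x x"
            unfolding b'_def using a insert.prems(2)[of ?e x] by (simp add: b)
          then show ?thesis using insert.prems(3) by metis
        qed
        show "b' (axis j 1) y = 0" if "j \<notin> I" for j y
        proof (cases "j = i")
          case True
          then show ?thesis using a insert.prems(2)[of y ?e] by (simp add: b'_def)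
        next
          case False
          then show ?thesis using insert.prems(4) that by (simp add: b'_def)
        qed
      qed
      moreover have "0 \<le> mtrace h u (\<lambda>x y. b x ?e * b y ?e)"
        by (rule mtrace_square_nonneg[OF assms(1) bilinearD(2)[OF insert.prems(1)]])
      moreover have "b = (\<lambda>x y. b' x y + 1 / ?a * (b x ?e * b y ?e))"
        by (simp add: b'_def fun_eq_iff)
      from arg_cong[OF this, of "mtrace h u"]
      have "mtrace h u b = mtrace h u b' + 1 / ?a * mtrace h u (\<lambda>x y. b x ?e * b y ?e)"
        unfolding mtrace_add mtrace_mult .
      ultimately show ?thesis using a by simp
    qed
  qed
  from this[of UNIV] show ?thesis using assms by simp
qed

end

section \<open>The pullback connection, the second fundamental form and the tension field\<close>

locale immersion_chart = metric_chart U g + N: contact_chart V h K \<xi> \<phi> c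
  for U :: "(real ^ 'q::finite) set" and g :: "'q lmetric"
    and V :: "(real ^ 'm::finite) set" and h :: "'m lmetric"
    and K :: structure_kind and \<xi> :: "'m lvec" and \<phi> :: "'m lendo" and c :: real +
  fixes P :: "real ^ 'q \<Rightarrow> real ^ 'm"
  assumes smooth_P: "smooth_on U P"
    and P_image: "P ` U \<subseteq> V"
    and isometric: "u \<in> U \<Longrightarrow> h (P u) (dd P u v) (dd P u w) = g u v w"
begin

abbreviation PN :: "real ^ 'q \<Rightarrow> (real ^ 'q \<Rightarrow> real ^ 'm) \<Rightarrow> real ^ 'q \<Rightarrow> real ^ 'm" where
  "PN x W \<equiv> pullback_nabla h P (\<lambda>_. x) W"

abbreviation SF :: "real ^ 'q \<Rightarrow> real ^ 'q \<Rightarrow> real ^ 'q \<Rightarrow> real ^ 'm" where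
  "SF x y \<equiv> second_fund g h P (\<lambda>_. x) (\<lambda>_. y)"

abbreviation \<tau> :: "real ^ 'q \<Rightarrow> real ^ 'm" where
  "\<tau> \<equiv> tension g h P"

lemma P_in: "u \<in> U \<Longrightarrow> P u \<in> V"
  using P_image by blast

lemma differentiable_P: "u \<in> U \<Longrightarrow> P differentiable (at u)"
  by (rule smooth_on_differentiable[OF smooth_P])

lemma smooth_bil_P: "smooth_bil V b \<Longrightarrow> smooth_bil U (\<lambda>s. b (P s))"
  unfolding smooth_bil_def using P_in smooth_on_compose[OF open_S P_image _ smooth_P] by blast

lemma smooth_lin_dP: "smooth_lin U (dd P)"
  unfolding smooth_lin_def using linear_dd[OF differentiable_P] smooth_on_dd[OF smooth_P] by blast

lemma smooth_PN: "smooth_on U W \<Longrightarrow> smooth_on U (PN x W)"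
  unfolding pullback_nabla_def
  by (intro smooth_on_add smooth_on_dd open_S smooth_P smooth_bil_apply[OF _ smooth_bil_P[OF N.smooth_christoffel]])

lemma PN_field: "pullback_nabla h P X W u = PN (X u) W u"
  by (simp add: pullback_nabla_def)

lemma linear_PN:
  assumes "u \<in> U" "W differentiable (at u)"
  shows "linear (\<lambda>x. PN x W u)"
  unfolding pullback_nabla_def
  by (rule linearI; simp add: linear_add[OF linear_dd[OF assms(2)]] linear_cmul[OF linear_dd[OF assms(2)]]
      linear_add[OF linear_dd[OF differentiable_P[OF assms(1)]]]
      linear_cmul[OF linear_dd[OF differentiable_P[OF assms(1)]]]
      bilinear_simps[OF N.bilinear_christoffel[OF P_in[OF assms(1)]]] algebra_simps)

lemma PN_metric:
  assumes "u \<in> U" "W differentiable (at u)" "W' differentiable (at u)"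
  shows "dd (\<lambda>s. h (P s) (W s) (W' s)) u x = h (P u) (PN x W u) (W' u) + h (P u) (W u) (PN x W' u)"
proof -
  have "(\<lambda>s. h s v w) differentiable (at (P u))" for v w
    using N.smooth_h smooth_on_differentiable P_in[OF assms(1)] unfolding smooth_bil_def by blast
  from dd_compose[OF this differentiable_P[OF assms(1)]] show ?thesis
    unfolding smooth_bil_dd(1)[OF open_S assms(1) smooth_bil_P[OF N.smooth_h] assms(2,3)] pullback_nabla_def
    by (simp add: N.metric_compat[OF P_in[OF assms(1)]] bilinear_simps[OF N.bil[OF P_in[OF assms(1)]]])
qed

lemma differentiable_dP: "u \<in> U \<Longrightarrow> (\<lambda>s. dd P s x) differentiable (at u)"
  by (rule smooth_on_differentiable[OF smooth_on_dd[OF smooth_P]])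

lemma PN_dP_sym: "u \<in> U \<Longrightarrow> PN x (\<lambda>s. dd P s y) u = PN y (\<lambda>s. dd P s x) u"
  unfolding pullback_nabla_def
  using second_derivative_symmetric[OF open_S smooth_P, of u y x]
    N.christoffel_sym[OF P_in, of u "dd P u x" "dd P u y"] by simp

lemma SF_eq: "SF x y u = PN x (\<lambda>s. dd P s y) u - dd P u (christoffel g u x y)"
  by (simp add: second_fund_def nabla_const)

lemma SF_sym: "u \<in> U \<Longrightarrow> SF x y u = SF y x u"
  unfolding SF_eq using PN_dP_sym christoffel_sym by metis

text \<open>Both \<open>h (\<nabla>\<^sub>x dP y, dP z)\<close> and \<open>g (\<nabla>\<^sub>x y, z)\<close> are symmetric in \<open>x, y\<close> and have the same
  symmetrisation in \<open>y, z\<close>, so their difference is alternating in \<open>y, z\<close> and symmetric in \<open>x, y\<close>: it is zero.\<close>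

lemma SF_normal:
  assumes "u \<in> U" shows "h (P u) (SF x y u) (dd P u z) = 0"
proof -
  define E where "E x y z = h (P u) (PN x (\<lambda>s. dd P s y) u) (dd P u z) - g u (christoffel g u x y) z" for x y z
  have "E x y z = - E x z y" for x y z
  proof -
    have "dd (\<lambda>s. g s y z) u x = dd (\<lambda>s. h (P s) (dd P s y) (dd P s z)) u x"
      by (rule dd_cong[OF open_S assms]) (simp add: isometric)
    then show ?thesis
      unfolding PN_metric[OF assms differentiable_dP[OF assms] differentiable_dP[OF assms]] metric_compat[OF assms]
        E_def using sym[OF assms] N.sym[OF P_in[OF assms]] by (simp add: algebra_simps)
  qed
  moreover have "E x y z = E y x z" for x y z
    unfolding E_def using PN_dP_sym[OF assms] christoffel_sym[OF assms] by metis
  ultimately have "E x y z = 0" by (smt (verit))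
  then show ?thesis
    unfolding SF_eq E_def by (simp add: bilinear_simps[OF N.bil[OF P_in[OF assms]]] isometric[OF assms])
qed

lemma tension_h: "u \<in> U \<Longrightarrow> h (P u) (\<tau> u) w = mtrace g u (\<lambda>x y. h (P u) (SF x y u) w)"
  unfolding tension_def
  by (rule mtrace_linear[of "\<lambda>v. h (P u) v w"]) (rule bilinearD(2)[OF N.bil[OF P_in]])

lemma tension_normal: "u \<in> U \<Longrightarrow> h (P u) (\<tau> u) (dd P u z) = 0"
  unfolding tension_h by (simp add: SF_normal mtrace_def)

lemma smooth_tension: "smooth_on U \<tau>"
  unfolding tension_def mtrace_def SF_eq using smooth_christoffel
  by (intro smooth_on_sum smooth_on_scaleR smooth_on_diff smooth_gram_inv open_S smooth_PN smooth_on_dd smooth_P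
      smooth_lin_apply[OF _ smooth_lin_dP]) (auto simp: smooth_bil_def)

text \<open>Weingarten's relation, obtained by differentiating \<open>tension_normal\<close>. The
  tangential correction in \<open>SF\<close> drops out because \<tau> is normal.\<close>

lemma PN_tension_dP:
  assumes "u \<in> U" shows "h (P u) (PN x \<tau> u) (dd P u y) = - h (P u) (SF x y u) (\<tau> u)"
proof -
  have "dd (\<lambda>s. h (P s) (\<tau> s) (dd P s y)) u x = dd (\<lambda>_. 0) u x"
    by (rule dd_cong[OF open_S assms tension_normal])
  then have "h (P u) (PN x \<tau> u) (dd P u y) + h (P u) (\<tau> u) (PN x (\<lambda>s. dd P s y) u) = 0"
    using PN_metric[OF assms smooth_on_differentiable[OF smooth_tension assms] differentiable_dP[OF assms]] by simp
  then show ?thesis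
    unfolding SF_eq using tension_normal[OF assms] N.sym[OF P_in[OF assms]]
    by (simp add: bilinear_simps[OF N.bil[OF P_in[OF assms]]])
qed

text \<open>Expand the non-negative trace of \<open>h (P u) (E x) (E y)\<close>. Pairing with
  \<open>dd P u\<close> sees only the tangential part of the derivative of \<tau>, so the normal
  part never has to be split off.\<close>

lemma trace_PN_tension_ge:
  assumes "u \<in> U"
  shows "(h (P u) (\<tau> u) (\<tau> u))\<^sup>2 / CARD('q) \<le> mtrace g u (\<lambda>x y. h (P u) (PN x \<tau> u) (PN y \<tau> u))"
proof -
  note hs = bilinear_simps[OF N.bil[OF P_in[OF assms]]]
  have Pu: "P u \<in> V" by (rule P_in[OF assms])
  define n where "n = h (P u) (\<tau> u) (\<tau> u)"
  define l where "l = n / CARD('q)" \<comment> \<open>minimises the trace of \<open>h (E x) (E y)\<close>\<close>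
  define E where "E x = PN x \<tau> u + l *\<^sub>R dd P u x" for x
  have tr: "mtrace g u (\<lambda>x y. h (P u) (SF x y u) (\<tau> u)) = n"
    unfolding n_def tension_h[OF assms] ..
  have "linear E"
    unfolding E_def
    by (intro linear_compose_add linear_compose_scale_right linear_PN assms
        smooth_on_differentiable[OF smooth_tension] linear_dd[OF differentiable_P])
  then have "bilinear (\<lambda>x y. h (P u) (E x) (E y))"
    unfolding bilinear_def by (auto intro!: linearI simp: linear_add linear_cmul hs)
  then have "0 \<le> mtrace g u (\<lambda>x y. h (P u) (E x) (E y))"
  proof (rule mtrace_nonneg[OF assms])
    show "h (P u) (E x) (E y) = h (P u) (E y) (E x)" for x y by (rule N.sym[OF Pu])
    show "0 \<le> h (P u) (E x) (E x)" for x
      using N.pos[OF Pu, of "E x"] hs(9)[of 0] by (cases "E x = 0") auto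
  qed
  \<comment> \<open>The last two summands have trace \<open>- 2 * l * n\<close> plus
    \<open>l * l\<close> times the dimension of the submanifold, which for this \<open>l\<close> is
    \<open>- n * n\<close> over that dimension.\<close>
  also have "(\<lambda>x y. h (P u) (E x) (E y)) = (\<lambda>x y. h (P u) (PN x \<tau> u) (PN y \<tau> u)
      + (- 2 * l * h (P u) (SF x y u) (\<tau> u) + l\<^sup>2 * g u x y))"
    unfolding E_def
  proof (intro ext)
    fix x y
    show "h (P u) (PN x \<tau> u + l *\<^sub>R dd P u x) (PN y \<tau> u + l *\<^sub>R dd P u y)
      = h (P u) (PN x \<tau> u) (PN y \<tau> u) + (- 2 * l * h (P u) (SF x y u) (\<tau> u) + l\<^sup>2 * g u x y)"
      unfolding hs PN_tension_dP[OF assms] N.sym[OF Pu, of "dd P u x"] isometric[OF assms] SF_sym[OF assms, of y x]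
      by (simp add: power2_eq_square algebra_simps)
  qed
  finally show ?thesis
    unfolding mtrace_add mtrace_mult tr mtrace_metric[OF assms]
    by (simp add: n_def[symmetric] l_def power2_eq_square field_simps)
qed

text \<open>Tangency turns the pairings of \<open>dd P u x\<close> with \<xi> and \<phi> \<tau> into
  \<open>g u x z\<close> and \<open>g u x w\<close>, so the traces are the full squared lengths 1
  and \<open>n\<close>. Orthogonality of \<tau> and \<xi> admits \<open>curv_contact\<close> and
  makes \<phi> \<tau> as long as \<tau>.\<close>

lemma curv_trace:
  assumes "u \<in> U" "\<xi> (P u) \<in> range (dd P u)" "\<phi> (P u) (\<tau> u) \<in> range (dd P u)"
  shows "h (P u) (mtrace g u (\<lambda>x y. curv h (P u) (dd P u x) (\<tau> u) (dd P u y))) (\<tau> u)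
    = - h (P u) (\<tau> u) (\<tau> u) * (CARD('q) * f1 K c - f2 K c + 3 * f2 K c)"
proof -
  have Pu: "P u \<in> V" by (rule P_in[OF assms(1)])
  interpret C: contact_space "h (P u)" "\<xi> (P u)" "\<phi> (P u)" by (rule N.contact[OF Pu])
  obtain z where z: "\<xi> (P u) = dd P u z" using assms(2) by blast
  obtain w where w: "\<phi> (P u) (\<tau> u) = dd P u w" using assms(3) by blast
  define n where "n = h (P u) (\<tau> u) (\<tau> u)"
  have txi: "h (P u) (\<tau> u) (\<xi> (P u)) = 0" unfolding z by (rule tension_normal[OF assms(1)])
  have "h (P u) (mtrace g u (\<lambda>x y. curv h (P u) (dd P u x) (\<tau> u) (dd P u y))) (\<tau> u)
    = mtrace g u (\<lambda>x y. h (P u) (curv h (P u) (dd P u x) (\<tau> u) (dd P u y)) (\<tau> u))"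
    by (rule mtrace_linear[of "\<lambda>v. h (P u) v (\<tau> u)"]) (rule bilinearD(2)[OF C.bil])
  also have "(\<lambda>x y. h (P u) (curv h (P u) (dd P u x) (\<tau> u) (dd P u y)) (\<tau> u))
    = (\<lambda>x y. - f1 K c * n * g u x y + (f2 K c * n * (g u x z * g u y z) + - 3 * f2 K c * (g u x w * g u y w)))"
    unfolding N.curv_contact[OF Pu txi] z w isometric[OF assms(1)] tension_normal[OF assms(1)] n_def
    by (simp add: fun_eq_iff)
  also have "mtrace g u \<dots> = - f1 K c * n * CARD('q) + (f2 K c * n * g u z z + - 3 * f2 K c * g u w w)"
    unfolding mtrace_add mtrace_mult mtrace_metric[OF assms(1)] mtrace_rank_one[OF assms(1)] ..
  also have "g u z z = 1" using C.xi_xi unfolding z isometric[OF assms(1)] .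
  also have "g u w w = n"
    using C.phi_h[of "\<tau> u" "\<tau> u"] txi unfolding w isometric[OF assms(1)] n_def by simp
  finally show ?thesis unfolding n_def by (simp add: algebra_simps)
qed

text \<open>With \<tau> = q H, \<open>n\<close> is q^2 |H|^2 and the left-hand side is q |H|^2. The
  Laplacian carries a plus sign because \<open>F_fun\<close> subtracts \<open>pos_laplacian\<close>,
  the negative of the trace used here.\<close>

lemma f_biharmonic_bound:
  assumes u: "u \<in> U" and xi: "\<xi> (P u) \<in> range (dd P u)" and phi: "\<phi> (P u) (\<tau> u) \<in> range (dd P u)"
    and const: "\<And>s. s \<in> U \<Longrightarrow> h (P s) (\<tau> s) (\<tau> s) = n" and "0 < n" "0 < F u"
    and eq: "F u *\<^sub>R bitension g h P u + local_laplacian g F u *\<^sub>R \<tau> u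
      + 2 *\<^sub>R pullback_nabla h P (local_grad g F) \<tau> u = 0"
  shows "n / CARD('q) \<le> CARD('q) * f1 K c - f2 K c + 3 * f2 K c + local_laplacian g F u / F u"
proof -
  have Pu: "P u \<in> V" by (rule P_in[OF u])
  note hs = bilinear_simps[OF N.bil[OF Pu]]
  note dt = smooth_on_differentiable[OF smooth_tension]
  define b where "b = mtrace g u (\<lambda>x y. h (P u) (PN x \<tau> u) (PN y \<tau> u))"
  \<comment> \<open>Established on all of \<open>U\<close>, because \<open>second\<close>
    differentiates it.\<close>
  have orth: "h (P s) (PN x \<tau> s) (\<tau> s) = 0" if "s \<in> U" for s x
  proof -
    have "dd (\<lambda>s. h (P s) (\<tau> s) (\<tau> s)) s x = dd (\<lambda>_. n) s x"
      by (rule dd_cong[OF open_S that const])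
    then show ?thesis
      unfolding PN_metric[OF that dt[OF that] dt[OF that]] using N.sym[OF P_in[OF that], of "\<tau> s"] by simp
  qed
  have second: "h (P u) (PN x (PN y \<tau>) u) (\<tau> u) = - h (P u) (PN x \<tau> u) (PN y \<tau> u)" for x y
  proof -
    have "dd (\<lambda>s. h (P s) (PN y \<tau> s) (\<tau> s)) u x = dd (\<lambda>_. 0) u x"
      by (rule dd_cong[OF open_S u orth])
    then show ?thesis
      unfolding PN_metric[OF u smooth_on_differentiable[OF smooth_PN[OF smooth_tension] u] dt[OF u]]
      using N.sym[OF Pu, of "PN y \<tau> u"] by simp
  qed
  have "h (P u) (section_laplacian g h P \<tau> u) (\<tau> u) = mtrace g u (\<lambda>x y.
      h (P u) (PN x (PN y \<tau>) u - pullback_nabla h P (nabla g (\<lambda>_. x) (\<lambda>_. y)) \<tau> u) (\<tau> u))"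
    unfolding section_laplacian_def
    by (rule mtrace_linear[of "\<lambda>v. h (P u) v (\<tau> u)"]) (rule bilinearD(2)[OF N.bil[OF Pu]])
  also have "\<dots> = mtrace g u (\<lambda>x y. - 1 * h (P u) (PN x \<tau> u) (PN y \<tau> u))"
    unfolding hs PN_field[of "nabla g _ _"] orth[OF u] second by simp
  also have "\<dots> = - b" unfolding mtrace_mult b_def by simp
  finally have lap: "h (P u) (section_laplacian g h P \<tau> u) (\<tau> u) = - b" .
  define t where "t = h (P u) (bitension g h P u) (\<tau> u)"
  define C where "C = CARD('q) * f1 K c - f2 K c + 3 * f2 K c"
  have t: "t = - b + n * C"
    unfolding t_def C_def bitension_def hs lap curv_trace[OF u xi phi] const[OF u] by simp
  have "F u * t + local_laplacian g F u * n = 0"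
    using arg_cong[OF eq, of "\<lambda>v. h (P u) v (\<tau> u)"]
    unfolding t_def hs PN_field[of "local_grad g F"] orth[OF u] const[OF u] by simp
  then have "b = n * (C + local_laplacian g F u / F u)"
    using \<open>0 < F u\<close> unfolding t by (simp add: field_simps)
  moreover have "n\<^sup>2 / CARD('q) \<le> b"
    using trace_PN_tension_ge[OF u] unfolding b_def const[OF u] .
  ultimately have "n * (n / CARD('q)) \<le> n * (C + local_laplacian g F u / F u)"
    by (simp add: power2_eq_square)
  \<comment> \<open>Cancelling one factor \<open>n\<close> is where non-minimality enters.\<close>
  then show ?thesis unfolding C_def using \<open>0 < n\<close> by (simp only: mult_le_cancel_left_pos)
qed

end

section \<open>The bound on the mean curvature\<close>

lemma metric_on_subset: "metric_on S h \<Longrightarrow> open T \<Longrightarrow> T \<subseteq> S \<Longrightarrow> metric_on T h"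
  unfolding metric_on_def smooth_bil_def using smooth_on_subset by blast

lemma riemannian_manifold_metric_on:
  assumes "riemannian_manifold A h" "\<kappa> \<in> A"
  shows "metric_on (cimg \<kappa>) (h \<kappa>)"
  using assms unfolding riemannian_manifold_def smooth_atlas_def riemannian_metric_def
    metric_on_def smooth_bil_def by blast

lemma nabla_phi_rhs_cong:
  "(\<And>v. \<eta> u v = \<eta>' u v) \<Longrightarrow> nabla_phi_rhs K h \<xi> \<eta> \<phi> u x y = nabla_phi_rhs K h \<xi> \<eta>' \<phi> u x y"
  by (cases K) simp_all

lemma space_form_contact_chart:
  assumes "space_form K A h \<xi> \<eta> \<phi> c" "\<mu> \<in> A"
  shows "contact_chart (cimg \<mu>) (h \<mu>) K (\<xi> \<mu>) (\<phi> \<mu>) c"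
proof -
  have acm: "almost_contact_metric_manifold A h \<xi> \<eta> \<phi>"
    and nabla: "\<And>u x y. u \<in> cimg \<mu> \<Longrightarrow> nabla_endo (h \<mu>) (\<phi> \<mu>) (\<lambda>_. x) (\<lambda>_. y) u
        = nabla_phi_rhs K (h \<mu>) (\<xi> \<mu>) (\<eta> \<mu>) (\<phi> \<mu>) u x y"
    and sect: "constant_phi_sectional_curvature A h \<eta> \<phi> c"
    using assms unfolding space_form_def by blast+
  have met: "metric_on (cimg \<mu>) (h \<mu>)"
    using acm riemannian_manifold_metric_on[OF _ assms(2)] unfolding almost_contact_metric_manifold_def by blast
  have contact: "\<eta> \<mu> u (\<xi> \<mu> u) = 1" "\<And>v. \<phi> \<mu> u (\<phi> \<mu> u v) = - v + \<eta> \<mu> u v *\<^sub>R \<xi> \<mu> u"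
    "\<And>v w. h \<mu> u (\<phi> \<mu> u v) (\<phi> \<mu> u w) = h \<mu> u v w - \<eta> \<mu> u v * \<eta> \<mu> u w"
    and eta: "\<And>v. \<eta> \<mu> u v = h \<mu> u v (\<xi> \<mu> u)" if "u \<in> cimg \<mu>" for u
    using acm assms(2) that unfolding almost_contact_metric_manifold_def by blast+
  have phi: "smooth_lin (cimg \<mu>) (\<phi> \<mu>)"
    using acm assms(2) unfolding almost_contact_metric_manifold_def endo_field_def smooth_lin_def by blast
  show ?thesis
  proof (intro contact_chart.intro metric_chart.intro contact_chart_axioms.intro met phi)
    show "smooth_on (cimg \<mu>) (\<xi> \<mu>)"
      using acm assms(2) unfolding almost_contact_metric_manifold_def vector_field_def by blast
    fix u assume u: "u \<in> cimg \<mu>"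
    show "contact_space (h \<mu> u) (\<xi> \<mu> u) (\<phi> \<mu> u)"
      using metric_chart.bil[OF metric_chart.intro[OF met] u] metric_chart.sym[OF metric_chart.intro[OF met] u]
        metric_chart.pos[OF metric_chart.intro[OF met] u] phi u contact[OF u, unfolded eta[OF u]]
      by (intro contact_space.intro) (auto simp: smooth_lin_def)
    show "nabla_endo (h \<mu>) (\<phi> \<mu>) (\<lambda>_. x) (\<lambda>_. y) u
        = nabla_phi_rhs K (h \<mu>) (\<xi> \<mu>) (\<lambda>s v. h \<mu> s v (\<xi> \<mu> s)) (\<phi> \<mu>) u x y" for x y
      unfolding nabla[OF u] by (rule nabla_phi_rhs_cong) (rule eta[OF u])
    show "sectional (h \<mu>) u x (\<phi> \<mu> u x) = c" if "x \<noteq> 0" "h \<mu> u x (\<xi> \<mu> u) = 0" for x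
      using sect assms(2) u that eta[OF u] unfolding constant_phi_sectional_curvature_def by metis
  qed
qed

lemma open_repdom:
  assumes "smooth_atlas B" "smooth_atlas A" "continuous_on UNIV \<psi>" "\<kappa> \<in> B" "\<mu> \<in> A"
  shows "open (repdom \<kappa> \<mu> \<psi>)"
proof -
  have k: "open (cdom \<kappa>)" "open (cimg \<kappa>)" "homeomorphism (cdom \<kappa>) (cimg \<kappa>) (coord \<kappa>) (param \<kappa>)"
    and "open (cdom \<mu>)"
    using assms unfolding smooth_atlas_def by blast+
  then have "open (\<psi> -` cdom \<mu>)" using assms(3) by (simp add: open_vimage)
  then have "openin (top_of_set (cdom \<kappa>)) (cdom \<kappa> \<inter> \<psi> -` cdom \<mu>)"
    by (rule openin_open_Int)
  then have "openin (top_of_set (cimg \<kappa>)) (repdom \<kappa> \<mu> \<psi>)"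
    unfolding repdom_def by (rule homeomorphism_imp_open_map[OF k(3)])
  then show ?thesis using k(2) openin_open_trans by blast
qed

lemma param_coord: "smooth_atlas B \<Longrightarrow> \<kappa> \<in> B \<Longrightarrow> p \<in> cdom \<kappa> \<Longrightarrow> param \<kappa> (coord \<kappa> p) = p"
  unfolding smooth_atlas_def by (meson homeomorphism_apply1)

lemma immersion_chart_rep:
  assumes "space_form K A h \<xi> \<eta> \<phi> c" "riemannian_manifold B g" "isometric_immersion B g A h \<psi>"
    and "\<kappa> \<in> B" "\<mu> \<in> A"
  shows "immersion_chart (repdom \<kappa> \<mu> \<psi>) (g \<kappa>) (cimg \<mu>) (h \<mu>) K (\<xi> \<mu>) (\<phi> \<mu>) c (rep \<kappa> \<mu> \<psi>)"
proof (intro immersion_chart.intro immersion_chart_axioms.intro metric_chart.intro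
    space_form_contact_chart[OF assms(1,5)])
  have B: "smooth_atlas B" and A: "smooth_atlas A"
    using assms(1,2) unfolding space_form_def almost_contact_metric_manifold_def riemannian_manifold_def
    by blast+
  have "continuous_on UNIV \<psi>" using assms(3) unfolding isometric_immersion_def by blast
  then have "open (repdom \<kappa> \<mu> \<psi>)" by (rule open_repdom[OF B A _ assms(4,5)])
  then show "metric_on (repdom \<kappa> \<mu> \<psi>) (g \<kappa>)"
    by (rule metric_on_subset[OF riemannian_manifold_metric_on[OF assms(2,4)]])
      (auto simp: repdom_def cimg_def)
  show "smooth_on (repdom \<kappa> \<mu> \<psi>) (rep \<kappa> \<mu> \<psi>)"
    using assms unfolding isometric_immersion_def by blast
  show "rep \<kappa> \<mu> \<psi> ` repdom \<kappa> \<mu> \<psi> \<subseteq> cimg \<mu>"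
    unfolding repdom_def rep_def cimg_def using param_coord[OF B assms(4)] by auto
  show "h \<mu> (rep \<kappa> \<mu> \<psi> u) (dd (rep \<kappa> \<mu> \<psi>) u v) (dd (rep \<kappa> \<mu> \<psi>) u w) = g \<kappa> u v w"
    if "u \<in> repdom \<kappa> \<mu> \<psi>" for u v w
    using assms that unfolding isometric_immersion_def by blast
qed

lemma tension_eq_mean_curvature:
  fixes P :: "real ^ 'q::finite \<Rightarrow> real ^ 'm::finite"
  shows "tension g h P u = real CARD('q) *\<^sub>R mean_curvature_vector g h P u"
  by (simp add: tension_def mean_curvature_vector_def)

lemma f_biharmonic_F_fun_ge:
  fixes B :: "('b::{t2_space,second_countable_topology}, 'q::finite) chart set"
    and A :: "('a::{t2_space,second_countable_topology}, 'm::finite) chart set"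
  assumes sf: "space_form K A h \<xi> \<eta> \<phi> c"
    and rm: "riemannian_manifold B g"
    and im: "isometric_immersion B g A h \<psi>"
    and mc: "mean_curvature_constant B g A h \<psi> r"
    and xi: "xi_tangent B A \<xi> \<psi>"
    and phi: "phi_H_tangent B g A h \<phi> \<psi>"
    and f: "\<forall>p. 0 < f p"
    and bih: "f_biharmonic B g A h f \<psi>"
    and nonmin: "\<not> minimal B g A h \<psi>"
  shows "0 < r\<^sup>2" "real CARD('q) * r\<^sup>2 \<le> F_fun K B g f c p"
proof -
  have B: "smooth_atlas B" and A: "smooth_atlas A"
    using sf rm unfolding space_form_def almost_contact_metric_manifold_def riemannian_manifold_def
    by blast+
  have norm: "h \<mu> (rep \<kappa> \<mu> \<psi> u) (tension (g \<kappa>) (h \<mu>) (rep \<kappa> \<mu> \<psi>) u) (tension (g \<kappa>) (h \<mu>) (rep \<kappa> \<mu> \<psi>) u)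
      = (real CARD('q))\<^sup>2 * r\<^sup>2"
    if "\<kappa> \<in> B" "\<mu> \<in> A" "u \<in> repdom \<kappa> \<mu> \<psi>" for \<kappa> \<mu> u
  proof -
    interpret immersion_chart "repdom \<kappa> \<mu> \<psi>" "g \<kappa>" "cimg \<mu>" "h \<mu>" K "\<xi> \<mu>" "\<phi> \<mu>" c "rep \<kappa> \<mu> \<psi>"
      by (rule immersion_chart_rep[OF sf rm im that(1,2)])
    let ?H = "mean_curvature_vector (g \<kappa>) (h \<mu>) (rep \<kappa> \<mu> \<psi>) u"
    note hs = bilinear_simps[OF N.bil[OF P_in[OF that(3)]]]
    have "0 \<le> h \<mu> (rep \<kappa> \<mu> \<psi> u) ?H ?H"
      using N.pos[OF P_in[OF that(3)], of ?H] hs(9)[of 0] by (cases "?H = 0") auto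
    moreover have "sqrt (h \<mu> (rep \<kappa> \<mu> \<psi> u) ?H ?H) = r"
      using mc that unfolding mean_curvature_constant_def Let_def by blast
    ultimately have "h \<mu> (rep \<kappa> \<mu> \<psi> u) ?H ?H = r\<^sup>2" using real_sqrt_pow2 by metis
    then show ?thesis unfolding tension_eq_mean_curvature hs by (simp add: power2_eq_square)
  qed
  \<comment> \<open>One point with non-zero tension suffices: the length \<open>r\<close> is
    constant, so its positivity holds at every \<open>p\<close>.\<close>
  obtain \<kappa> \<mu> u where k: "\<kappa> \<in> B" "\<mu> \<in> A" "u \<in> repdom \<kappa> \<mu> \<psi>"
    and ne: "tension (g \<kappa>) (h \<mu>) (rep \<kappa> \<mu> \<psi>) u \<noteq> 0"
    using nonmin unfolding minimal_def by blast
  show r: "0 < r\<^sup>2"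
  proof -
    interpret immersion_chart "repdom \<kappa> \<mu> \<psi>" "g \<kappa>" "cimg \<mu>" "h \<mu>" K "\<xi> \<mu>" "\<phi> \<mu>" c "rep \<kappa> \<mu> \<psi>"
      by (rule immersion_chart_rep[OF sf rm im k(1,2)])
    show ?thesis
      using N.pos[OF P_in[OF k(3)] ne] unfolding norm[OF k] by (simp add: zero_less_mult_iff)
  qed
  \<comment> \<open>The very chart that \<open>laplacian\<close> selects at \<open>p\<close>, so its
    value is read off without comparing charts.\<close>
  define \<kappa> where "\<kappa> = (SOME \<kappa>. \<kappa> \<in> B \<and> p \<in> cdom \<kappa>)"
  have "\<exists>\<kappa>. \<kappa> \<in> B \<and> p \<in> cdom \<kappa>" using B unfolding smooth_atlas_def by blast
  from someI_ex[OF this] have \<kappa>: "\<kappa> \<in> B" "p \<in> cdom \<kappa>" unfolding \<kappa>_def by blast+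
  obtain \<mu> where \<mu>: "\<mu> \<in> A" "\<psi> p \<in> cdom \<mu>" using A unfolding smooth_atlas_def by blast
  interpret immersion_chart "repdom \<kappa> \<mu> \<psi>" "g \<kappa>" "cimg \<mu>" "h \<mu>" K "\<xi> \<mu>" "\<phi> \<mu>" c "rep \<kappa> \<mu> \<psi>"
    by (rule immersion_chart_rep[OF sf rm im \<kappa>(1) \<mu>(1)])
  define u where "u = coord \<kappa> p"
  have u: "u \<in> repdom \<kappa> \<mu> \<psi>" using \<kappa> \<mu> unfolding u_def repdom_def by blast
  have "param \<kappa> u = p" unfolding u_def by (rule param_coord[OF B \<kappa>])
  then have Fu: "(f \<circ> param \<kappa>) u = f p" by simp
  obtain w where w: "\<phi> \<mu> (rep \<kappa> \<mu> \<psi> u) (mean_curvature_vector (g \<kappa>) (h \<mu>) (rep \<kappa> \<mu> \<psi>) u)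
      = dd (rep \<kappa> \<mu> \<psi>) u w"
    using phi \<kappa> \<mu> u unfolding phi_H_tangent_def by blast
  have lp: "linear (\<phi> \<mu> (rep \<kappa> \<mu> \<psi> u))"
    using N.smooth_phi P_in[OF u] unfolding smooth_lin_def by blast
  have "\<phi> \<mu> (rep \<kappa> \<mu> \<psi> u) (\<tau> u) = dd (rep \<kappa> \<mu> \<psi>) u (real CARD('q) *\<^sub>R w)"
    unfolding tension_eq_mean_curvature linear_cmul[OF lp] w
    by (rule linear_cmul[OF linear_dd[OF differentiable_P[OF u]], symmetric])
  then have phi': "\<phi> \<mu> (rep \<kappa> \<mu> \<psi> u) (\<tau> u) \<in> range (dd (rep \<kappa> \<mu> \<psi>) u)" by blast
  have xi': "\<xi> \<mu> (rep \<kappa> \<mu> \<psi> u) \<in> range (dd (rep \<kappa> \<mu> \<psi>) u)"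
    using xi \<kappa> \<mu> u unfolding xi_tangent_def by blast
  have eq: "(f \<circ> param \<kappa>) u *\<^sub>R bitension (g \<kappa>) (h \<mu>) (rep \<kappa> \<mu> \<psi>) u
      + local_laplacian (g \<kappa>) (f \<circ> param \<kappa>) u *\<^sub>R \<tau> u
      + 2 *\<^sub>R pullback_nabla (h \<mu>) (rep \<kappa> \<mu> \<psi>) (local_grad (g \<kappa>) (f \<circ> param \<kappa>)) \<tau> u = 0"
    using bih \<kappa> \<mu> u unfolding f_biharmonic_def Let_def by blast
  have lap: "laplacian B g f p = local_laplacian (g \<kappa>) (f \<circ> param \<kappa>) u"
    unfolding laplacian_def Let_def \<kappa>_def[symmetric] u_def ..
  have "(real CARD('q))\<^sup>2 * r\<^sup>2 / real CARD('q)
      \<le> CARD('q) * f1 K c - f2 K c + 3 * f2 K c + local_laplacian (g \<kappa>) (f \<circ> param \<kappa>) u / (f \<circ> param \<kappa>) u"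
    by (rule f_biharmonic_bound[OF u xi' phi' norm[OF \<kappa>(1) \<mu>(1)] _ _ eq]) (use r f in \<open>simp_all add: Fu\<close>)
  then show "real CARD('q) * r\<^sup>2 \<le> F_fun K B g f c p"
    unfolding F_fun_def pos_laplacian_def lap Fu f3_def by (simp add: power2_eq_square)
qed

text \<open>Part (1) speaks of non-minimal immersions because a vanishing tension field solves the
  equation for every \<open>f\<close>. The infimum is taken in \<open>ereal\<close>, where it makes
  sense even if \<open>F_fun\<close> is unbounded below.\<close>

theorem theorem3p14:
  fixes S :: structure_kind and n :: nat and c r :: real
    and A :: "('a::{t2_space,second_countable_topology}, 'm::finite) chart set"
    and h :: "('a, 'm) chart \<Rightarrow> 'm lmetric"
    and \<xi> :: "('a, 'm) chart \<Rightarrow> 'm lvec"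
    and \<eta> :: "('a, 'm) chart \<Rightarrow> 'm lform"
    and \<phi> :: "('a, 'm) chart \<Rightarrow> 'm lendo"
    and B :: "('b::{t2_space,second_countable_topology}, 'q::finite) chart set"
    and g :: "('b, 'q) chart \<Rightarrow> 'q lmetric"
    and \<psi> :: "'b \<Rightarrow> 'a" and f :: "'b \<Rightarrow> real"
  assumes "CARD('m) = 2 * n + 1"
    and "space_form S A h \<xi> \<eta> \<phi> c"
    and "riemannian_manifold B g"
    and "isometric_immersion B g A h \<psi>"
    and "mean_curvature_constant B g A h \<psi> r"
    and "xi_tangent B A \<xi> \<psi>"
    and "phi_H_tangent B g A h \<phi> \<psi>"
    and "smooth_function B f"
    and "\<forall>p. 0 < f p"
  shows "((INF p. ereal (F_fun S B g f c p)) \<le> 0 \<and> \<not> minimal B g A h \<psi>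
            \<longrightarrow> \<not> f_biharmonic B g A h f \<psi>) \<and>
         (0 < (INF p. ereal (F_fun S B g f c p)) \<and> proper_f_biharmonic B g A h f \<psi>
            \<longrightarrow> 0 < r\<^sup>2 \<and>
                ereal (r\<^sup>2) \<le> ereal (1 / real CARD('q)) * (INF p. ereal (F_fun S B g f c p)))"
proof -
  define I where "I = (INF p. ereal (F_fun S B g f c p))"
  have bound: "0 < r\<^sup>2" "ereal (real CARD('q) * r\<^sup>2) \<le> I"
    if "f_biharmonic B g A h f \<psi>" "\<not> minimal B g A h \<psi>"
  proof -
    note * = f_biharmonic_F_fun_ge[OF assms(2-7,9) that]
    show "0 < r\<^sup>2" by (rule *(1))
    show "ereal (real CARD('q) * r\<^sup>2) \<le> I" unfolding I_def by (rule INF_greatest) (simp add: *(2))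
  qed
  have "\<not> f_biharmonic B g A h f \<psi>" if "I \<le> 0" "\<not> minimal B g A h \<psi>"
  proof
    assume "f_biharmonic B g A h f \<psi>"
    note * = bound[OF this that(2)]
    have "ereal (real CARD('q) * r\<^sup>2) \<le> 0" using *(2) that(1) by (rule order_trans)
    then have "real CARD('q) * r\<^sup>2 \<le> 0" by simp
    moreover have "0 < real CARD('q) * r\<^sup>2" using *(1) by simp
    ultimately show False by linarith
  qed
  moreover have "0 < r\<^sup>2 \<and> ereal (r\<^sup>2) \<le> ereal (1 / real CARD('q)) * I"
    if "proper_f_biharmonic B g A h f \<psi>"
  proof -
    have "f_biharmonic B g A h f \<psi>" "\<not> minimal B g A h \<psi>"
      using that unfolding proper_f_biharmonic_def by blast+
    note * = bound[OF this]
    have "ereal (1 / real CARD('q)) * ereal (real CARD('q) * r\<^sup>2) \<le> ereal (1 / real CARD('q)) * I"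
      by (rule ereal_mult_left_mono[OF *(2)]) simp
    then show ?thesis using *(1) by simp
  qed
  ultimately show ?thesis unfolding I_def by blast
qed

end
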